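(* Let $n\ge 2$, let $\omega(k)=\sum_{j=2}^n\omega_jk^j$ be a polynomial with real coefficients and $\omega_n\neq0$, let $q_o\in L^1(\mathbb R)\cap L^2(\mathbb R)$, and let $q(x,t)=\frac1{2\pi}\int_{-\infty}^\infty e^{ikx-i\omega(k)t}\hat q_o(k)\,dk$. Assume that $q_o$ has at least one jump discontinuity. Then $q(\cdot,t)\notin L^1(\mathbb R)$ for every $t>0$.
   Context: The Fourier transform is $\hat q_o(k)=\int_{\mathbb R}e^{-ikx}q_o(x)\,dx$, and the formula for $q(\cdot,t)$ is the inverse Fourier transform in $L^2(\mathbb R)$. To make "jump discontinuity" meaningful, the representative of $q_o$ is fixed by $\operatorname{Re}q_o(x)=\limsup_{\delta\downarrow0}\frac1{2\delta}\int_{|y-x|<\delta}\operatorname{Re}q_o(y)\,dy$ and $\operatorname{Im}q_o(x)=\limsup_{\delta\downarrow0}\frac1{2\delta}\int_{|y-x|<\delta}\operatorname{Im}q_o(y)\,dy$. A jump discontinuity is a point $c$ at which the one-sided limits $q_o(c^+)$ and $q_o(c^-)$ exist and are different. *)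

theory Defs
  imports "HOL-Analysis.Analysis"
begin

definition square_integrable :: "(real \<Rightarrow> complex) \<Rightarrow> bool" where
  "square_integrable f \<longleftrightarrow>
     f \<in> borel_measurable lebesgue \<and> integrable lebesgue (\<lambda>x. (cmod (f x))\<^sup>2)"

definition fourier :: "(real \<Rightarrow> complex) \<Rightarrow> real \<Rightarrow> complex" where
  "fourier f k = (LINT x|lebesgue. exp (- (\<i> * of_real k * of_real x)) * f x)"

text \<open>
  The inverse Fourier transform in $L^2$ is the $L^2$-limit of the truncated inversion integrals,
  so it is determined only up to null sets; it is therefore rendered as a relation between a
  function and any representative of its inverse transform. The limit exists for every $f$ in
  $L^2$ by Plancherel's theorem. Conversely, for locally integrable $f$ the existence of such a
  $g$ forces $f$ to be in $L^2$, so this is not required separately. The distance is measured by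
  the nonnegative integral, which is not subject to the convention that the Bochner integral of a
  non-integrable function is 0.
\<close>

definition has_L2_inverse_fourier ::
    "(real \<Rightarrow> complex) \<Rightarrow> (real \<Rightarrow> complex) \<Rightarrow> bool" where
  "has_L2_inverse_fourier f g \<longleftrightarrow>
     (\<forall>R. set_integrable lebesgue {-R..R} f) \<and>
     square_integrable g \<and>
     ((\<lambda>R. \<integral>\<^sup>+x. ennreal ((cmod (g x - 1 / (2 * of_real pi) *
          (LINT k:{-R..R}|lebesgue. exp (\<i> * of_real k * of_real x) * f k)))\<^sup>2) \<partial>lebesgue)
        \<longlongrightarrow> 0) at_top"

text \<open>
  The canonical representative is extended-real valued, since the upper limit may be infinite at
  some points. It depends only on the almost-everywhere class of $f$.
\<close>

definition canonical_rep :: "(real \<Rightarrow> real) \<Rightarrow> real \<Rightarrow> ereal" where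
  "canonical_rep f x =
     Limsup (at_right 0)
       (\<lambda>\<delta>. ereal (1 / (2 * \<delta>) * (LINT y:{y. \<bar>y - x\<bar> < \<delta>}|lebesgue. f y)))"

text \<open>The one-sided limits are required to be (finite) complex numbers.\<close>

definition rep_tendsto :: "(real \<Rightarrow> complex) \<Rightarrow> complex \<Rightarrow> real filter \<Rightarrow> bool" where
  "rep_tendsto f l F \<longleftrightarrow>
     (canonical_rep (\<lambda>y. Re (f y)) \<longlongrightarrow> ereal (Re l)) F \<and>
     (canonical_rep (\<lambda>y. Im (f y)) \<longlongrightarrow> ereal (Im l)) F"

definition jump_discontinuity :: "(real \<Rightarrow> complex) \<Rightarrow> real \<Rightarrow> bool" where
  "jump_discontinuity f c \<longleftrightarrow>
     (\<exists>l r. rep_tendsto f l (at_left c) \<and> rep_tendsto f r (at_right c) \<and> l \<noteq> r)"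

definition dispersion :: "nat \<Rightarrow> (nat \<Rightarrow> real) \<Rightarrow> real \<Rightarrow> real" where
  "dispersion n w k = (\<Sum>j=2..n. w j * k ^ j)"

end

theory Submission
  imports Defs "HOL-Probability.Characteristic_Functions" "HOL-Probability.Sinc_Integral"
begin

text \<open>
  If \<open>g = q(\<cdot>,t)\<close> were integrable, then \<open>q\<^sub>o\<close> would be recovered from \<open>g\<close> by running the dispersive
  evolution backwards, that is, by convolution with the kernel
  $K_R(z) = \frac1{2\pi}\int_{-R}^{R} e^{ikz + i\omega(k)t}\,dk$ in the limit of large \<open>R\<close>. As $\omega''$ is a
  nonzero polynomial, van der Corput's second-derivative test bounds $K_R$ uniformly in \<open>z\<close> and \<open>R\<close>.
  Continuity of translation in $L^1$ then makes the functions $K_R * g$ uniformly equicontinuous in \<open>R\<close>.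
  Their averages over an interval converge to those of \<open>q\<^sub>o\<close>, so the interval averages of \<open>q\<^sub>o\<close>, and
  with them the canonical representative, have a uniform modulus of continuity, which excludes jumps.
\<close>

subsection \<open>Van der Corput bounds for polynomial phases\<close>

text \<open>The linear term \<open>z * k\<close> of the phase disappears on differentiating twice,
  so a second-derivative bound is uniform in \<open>z\<close> for free; n >= 2 is what leaves a
  nonzero second derivative. The obstacle is that the Fourier transform of q_o need not be
  integrable, so its truncated inversion integrals may fail to converge pointwise. Hence no limit
  kernel and no continuous representative is built: estimates are made for finite \<open>R\<close>,
  integrated over an interval, and only then passed to the limit. The canonical representative fits
  this scheme, since an upper limit of averages inherits any bound on differences of averages that
  does not depend on the radius. At the other end, q(.,t) is tied to q_o only by an L2 limit of
  truncated integrals, so the relation between the two Fourier transforms must itself be derived. In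
  it the unimodular factor exp(-i omega(k) t) moves to the other side by conjugation, which reverses
  time and leaves an oscillatory kernel of the same kind.\<close>

lemma van_der_corput_first:
  fixes \<phi> \<phi>' \<phi>'' :: "real \<Rightarrow> real"
  assumes "a \<le> b" "m > 0"
    and d1: "\<And>x. x \<in> {a..b} \<Longrightarrow> (\<phi> has_real_derivative \<phi>' x) (at x)"
    and d2: "\<And>x. x \<in> {a..b} \<Longrightarrow> (\<phi>' has_real_derivative \<phi>'' x) (at x)"
    and c2: "continuous_on {a..b} \<phi>''"
    and nonneg: "\<And>x. x \<in> {a..b} \<Longrightarrow> \<phi>'' x \<ge> 0"
    and lower: "\<And>x. x \<in> {a..b} \<Longrightarrow> \<phi>' x \<ge> m"
  shows "norm (integral {a..b} (\<lambda>x. cis (\<phi> x))) \<le> 2 / m"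
proof -
  \<comment> \<open>Integration by parts in differentiated form: \<open>G\<close> is
    \<open>cis (\<phi> x)\<close> divided by \<open>\<i> * \<phi>' x\<close>, and \<open>E\<close>
    is the extra term that arises when the derivative falls on \<open>1 / \<phi>'\<close>.\<close>
  define G where "G x = - \<i> * cis (\<phi> x) * of_real (1 / \<phi>' x)" for x
  define E where "E x = \<i> * cis (\<phi> x) * of_real (\<phi>'' x / (\<phi>' x)\<^sup>2)" for x
  have pos: "\<phi>' x > 0" if "x \<in> {a..b}" for x
    using lower[OF that] \<open>m > 0\<close> by linarith
  have cont1: "continuous_on {a..b} \<phi>'" "continuous_on {a..b} \<phi>"
    using d1 d2 by (auto intro!: DERIV_atLeastAtMost_imp_continuous_on)
  have dG: "(G has_vector_derivative (cis (\<phi> x) + E x)) (at x within {a..b})" if x: "x \<in> {a..b}" for x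
  proof -
    have "((\<lambda>x. cis (\<phi> x)) has_vector_derivative (\<phi>' x *\<^sub>R (\<i> * cis (\<phi> x)))) (at x)"
      using field_vector_diff_chain_at[OF has_vector_derivative_mult_right[OF has_vector_derivative_of_real
            [OF d1[OF x]], of \<i>] DERIV_exp]
      by (simp add: o_def cis_conv_exp scaleR_conv_of_real mult_ac)
    moreover have "((\<lambda>x. complex_of_real (1 / \<phi>' x)) has_vector_derivative of_real (- \<phi>'' x / (\<phi>' x)\<^sup>2)) (at x)"
      using pos[OF x] 
      by (intro has_vector_derivative_of_real)
         (auto intro!: derivative_eq_intros d2[OF x] simp: has_real_derivative_iff_has_vector_derivative[symmetric] power2_eq_square)
    ultimately have "(G has_vector_derivative (- \<i> * cis (\<phi> x) * of_real (- \<phi>'' x / (\<phi>' x)\<^sup>2)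
         + - \<i> * (\<phi>' x *\<^sub>R (\<i> * cis (\<phi> x))) * of_real (1 / \<phi>' x))) (at x)"
      unfolding G_def by (intro has_vector_derivative_mult has_vector_derivative_mult_right)
    moreover have "- \<i> * cis (\<phi> x) * of_real (- \<phi>'' x / (\<phi>' x)\<^sup>2)
         + - \<i> * (\<phi>' x *\<^sub>R (\<i> * cis (\<phi> x))) * of_real (1 / \<phi>' x) = cis (\<phi> x) + E x"
      using pos[OF x] unfolding E_def by (simp add: scaleR_conv_of_real field_simps)
    ultimately show ?thesis by (metis has_vector_derivative_at_within)
  qed
  have dinv: "((\<lambda>x. - (1 / \<phi>' x)) has_vector_derivative (\<phi>'' x / (\<phi>' x)\<^sup>2)) (at x within {a..b})"
    if x: "x \<in> {a..b}" for x
    using pos[OF x]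
    by (auto intro!: derivative_eq_intros DERIV_subset[OF d2[OF x]]
         simp: has_real_derivative_iff_has_vector_derivative[symmetric] power2_eq_square)
  have I1: "((\<lambda>x. cis (\<phi> x) + E x) has_integral (G b - G a)) {a..b}"
    using fundamental_theorem_of_calculus[OF \<open>a \<le> b\<close> dG] .
  have I2: "((\<lambda>x. \<phi>'' x / (\<phi>' x)\<^sup>2) has_integral (1 / \<phi>' a - 1 / \<phi>' b)) {a..b}"
    using fundamental_theorem_of_calculus[OF \<open>a \<le> b\<close> dinv] by simp
  have cE: "continuous_on {a..b} E"
    unfolding E_def using pos c2 cont1 by (auto intro!: continuous_intros simp: less_imp_neq[symmetric]) 
  have iE: "E integrable_on {a..b}" using cE by (rule integrable_continuous_interval)
  \<comment> \<open>Since \<open>\<phi>''\<close> is nonnegative, the norm of \<open>E\<close> is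
    exactly the derivative of \<open>- 1 / \<phi>'\<close>, so its integral telescopes. Added to the
    boundary terms, the contributions at \<open>b\<close> cancel and \<open>2 / \<phi>' a\<close>
    remains.\<close>
  have nE: "norm (integral {a..b} E) \<le> 1 / \<phi>' a - 1 / \<phi>' b"
    unfolding integral_unique[OF I2, symmetric]
    using iE nonneg by (intro integral_norm_bound_integral has_integral_integrable[OF I2])
       (auto simp: E_def norm_mult norm_divide norm_power)
  have "integral {a..b} (\<lambda>x. cis (\<phi> x)) = G b - G a - integral {a..b} E"
    using has_integral_diff[OF I1 integrable_integral[OF iE]] by (simp add: integral_unique)
  also have "norm \<dots> \<le> norm (G b) + norm (G a) + norm (integral {a..b} E)"
    by (metis norm_triangle_ineq4 add_right_mono order_trans)
  also have "\<dots> \<le> 1 / \<phi>' b + 1 / \<phi>' a + (1 / \<phi>' a - 1 / \<phi>' b)"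
    using nE pos[of a] pos[of b] \<open>a \<le> b\<close> by (simp add: G_def norm_mult norm_divide)
  also have "\<dots> \<le> 2 / m"
    using lower[of a] \<open>a \<le> b\<close> \<open>m > 0\<close> by (simp add: frac_le)
  finally show ?thesis .
qed

lemma norm_integral_cis_le:
  fixes \<phi> :: "real \<Rightarrow> real"
  assumes "a \<le> b" "continuous_on {a..b} \<phi>"
  shows "norm (integral {a..b} (\<lambda>x. cis (\<phi> x))) \<le> b - a"
  using integral_bound[OF assms(1), of "\<lambda>x. cis (\<phi> x)" 1] assms(2)
  by (auto intro!: continuous_intros)

text \<open>From a nonnegative start, \<open>\<phi>'\<close> has reached \<open>c\<close> after one
  unit of length. The first unit costs at most its length, and the first-derivative test handles the
  rest. The cut at distance 1 is not optimized, because only a bound free of the interval and of the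
  linear part of the phase matters.\<close>

lemma van_der_corput_right:
  fixes \<phi> \<phi>' \<phi>'' :: "real \<Rightarrow> real"
  assumes "a \<le> b" "c > 0"
    and d1: "\<And>x. x \<in> {a..b} \<Longrightarrow> (\<phi> has_real_derivative \<phi>' x) (at x)"
    and d2: "\<And>x. x \<in> {a..b} \<Longrightarrow> (\<phi>' has_real_derivative \<phi>'' x) (at x)"
    and c2: "continuous_on {a..b} \<phi>''"
    and lower: "\<And>x. x \<in> {a..b} \<Longrightarrow> \<phi>'' x \<ge> c"
    and start: "\<phi>' a \<ge> 0"
  shows "norm (integral {a..b} (\<lambda>x. cis (\<phi> x))) \<le> 1 + 2 / c"
proof -
  have cont: "continuous_on {a..b} \<phi>"
    using d1 by (auto intro!: DERIV_atLeastAtMost_imp_continuous_on)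
  show ?thesis
  proof (cases "b \<le> a + 1")
    case True
    have "0 < 2 / c" using \<open>c > 0\<close> by simp
    then show ?thesis
      using norm_integral_cis_le[OF \<open>a \<le> b\<close> cont] True by linarith
  next
    case False
    have int: "(\<lambda>x. cis (\<phi> x)) integrable_on {a..b}"
      by (intro integrable_continuous_interval continuous_intros cont)
    have low: "\<phi>' x \<ge> c" if x: "x \<in> {a+1..b}" for x
    proof -
      obtain z where z: "a < z" "z < x" "\<phi>' x - \<phi>' a = (x - a) * \<phi>'' z"
        using MVT2[of a x \<phi>' \<phi>''] x d2 by auto
      have "(x - a) * \<phi>'' z \<ge> 1 * c"
        using lower[of z] z x \<open>c > 0\<close> by (intro mult_mono) auto
      then show ?thesis using z start by linarith
    qed
    have "integral {a..b} (\<lambda>x. cis (\<phi> x)) = integral {a..a+1} (\<lambda>x. cis (\<phi> x)) + integral {a+1..b} (\<lambda>x. cis (\<phi> x))"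
      using False int by (intro Henstock_Kurzweil_Integration.integral_combine[symmetric]) auto
    also have "norm \<dots> \<le> norm (integral {a..a+1} (\<lambda>x. cis (\<phi> x))) + norm (integral {a+1..b} (\<lambda>x. cis (\<phi> x)))"
      by (rule norm_triangle_ineq)
    also have "norm (integral {a..a+1} (\<lambda>x. cis (\<phi> x))) \<le> a + 1 - a"
      using False by (intro norm_integral_cis_le continuous_on_subset[OF cont]) auto
    also have "norm (integral {a+1..b} (\<lambda>x. cis (\<phi> x))) \<le> 2 / c"
      using False \<open>c > 0\<close> lower
      by (intro van_der_corput_first[of _ _ _ _ \<phi>' \<phi>''] d1 d2 low continuous_on_subset[OF c2])
         (auto intro: order_trans[OF less_imp_le[OF \<open>c > 0\<close>] lower])
    finally show ?thesis by simp
  qed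
qed

text \<open>The reflection of \<open>x\<close> to \<open>- x\<close> keeps the second derivative and
  flips the sign of the first, which turns this into the previous case.\<close>

lemma van_der_corput_left:
  fixes \<phi> \<phi>' \<phi>'' :: "real \<Rightarrow> real"
  assumes "a \<le> b" "c > 0"
    and d1: "\<And>x. x \<in> {a..b} \<Longrightarrow> (\<phi> has_real_derivative \<phi>' x) (at x)"
    and d2: "\<And>x. x \<in> {a..b} \<Longrightarrow> (\<phi>' has_real_derivative \<phi>'' x) (at x)"
    and c2: "continuous_on {a..b} \<phi>''"
    and lower: "\<And>x. x \<in> {a..b} \<Longrightarrow> \<phi>'' x \<ge> c"
    and start: "\<phi>' b \<le> 0"
  shows "norm (integral {a..b} (\<lambda>x. cis (\<phi> x))) \<le> 1 + 2 / c"
proof -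
  have "norm (integral {-b..-a} (\<lambda>x. cis (\<phi> (- x)))) \<le> 1 + 2 / c"
  proof (rule van_der_corput_right[of _ _ c _ "\<lambda>x. - \<phi>' (- x)" "\<lambda>x. \<phi>'' (- x)"])
    fix x assume x: "x \<in> {-b..-a}"
    show "((\<lambda>x. \<phi> (- x)) has_real_derivative - \<phi>' (- x)) (at x)"
      using d1[of "-x"] x by (auto simp: DERIV_mirror)
    show "((\<lambda>x. - \<phi>' (- x)) has_real_derivative \<phi>'' (- x)) (at x)"
      using d2[of "-x"] x by (auto simp: DERIV_mirror dest: DERIV_minus)
    show "\<phi>'' (- x) \<ge> c" using lower[of "-x"] x by auto
  next
    show "continuous_on {-b..-a} (\<lambda>x. \<phi>'' (- x))"
      by (rule continuous_on_compose2[OF c2]) (auto intro!: continuous_intros)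
  qed (use assms in auto)
  also have "integral {-b..-a} (\<lambda>x. cis (\<phi> (- x))) = integral {a..b} (\<lambda>x. cis (\<phi> x))"
    by (rule Henstock_Kurzweil_Integration.integral_reflect_real)
  finally show ?thesis .
qed

text \<open>The derivative \<open>\<phi>'\<close> is increasing, so either it has one sign that
  suits a one-sided lemma on the whole interval, or it vanishes at an interior point that splits the
  interval into one piece of each kind.\<close>

lemma van_der_corput_second:
  fixes \<phi> \<phi>' \<phi>'' :: "real \<Rightarrow> real"
  assumes "a \<le> b" "c > 0"
    and d1: "\<And>x. x \<in> {a..b} \<Longrightarrow> (\<phi> has_real_derivative \<phi>' x) (at x)"
    and d2: "\<And>x. x \<in> {a..b} \<Longrightarrow> (\<phi>' has_real_derivative \<phi>'' x) (at x)"
    and c2: "continuous_on {a..b} \<phi>''"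
    and lower: "\<And>x. x \<in> {a..b} \<Longrightarrow> \<phi>'' x \<ge> c"
  shows "norm (integral {a..b} (\<lambda>x. cis (\<phi> x))) \<le> 2 + 4 / c"
proof -
  have le: "1 + 2 / c \<le> 2 + 4 / c" using \<open>c > 0\<close> by (simp add: field_simps)
  consider "\<phi>' a \<ge> 0" | "\<phi>' b \<le> 0" | "\<phi>' a < 0" "\<phi>' b > 0" by linarith
  then show ?thesis
  proof cases
    case 1
    show ?thesis
      by (rule order_trans[OF van_der_corput_right[OF assms 1] le]) 
  next
    case 2
    show ?thesis
      by (rule order_trans[OF van_der_corput_left[OF assms 2] le])
  next
    case 3
    obtain p where p: "a \<le> p" "p \<le> b" "\<phi>' p = 0"
      using IVT'[of \<phi>' a 0 b, OF _ _ \<open>a \<le> b\<close> DERIV_atLeastAtMost_imp_continuous_on] 3 d2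
      by fastforce
    have cont: "continuous_on {a..b} \<phi>"
      using d1 by (auto intro!: DERIV_atLeastAtMost_imp_continuous_on)
    have "integral {a..b} (\<lambda>x. cis (\<phi> x)) = integral {a..p} (\<lambda>x. cis (\<phi> x)) + integral {p..b} (\<lambda>x. cis (\<phi> x))"
      using p cont by (intro Henstock_Kurzweil_Integration.integral_combine[symmetric]
          integrable_continuous_interval continuous_intros) auto
    also have "norm \<dots> \<le> norm (integral {a..p} (\<lambda>x. cis (\<phi> x))) + norm (integral {p..b} (\<lambda>x. cis (\<phi> x)))"
      by (rule norm_triangle_ineq)
    also have "norm (integral {a..p} (\<lambda>x. cis (\<phi> x))) \<le> 1 + 2 / c"
      using p \<open>c > 0\<close> by (intro van_der_corput_left[of _ _ _ _ \<phi>' \<phi>''] d1 d2 lower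
          continuous_on_subset[OF c2]) auto
    also have "norm (integral {p..b} (\<lambda>x. cis (\<phi> x))) \<le> 1 + 2 / c"
      using p \<open>c > 0\<close> by (intro van_der_corput_right[of _ _ _ _ \<phi>' \<phi>''] d1 d2 lower
          continuous_on_subset[OF c2]) auto
    finally show ?thesis by simp
  qed
qed

section \<open>Uniform bounds for oscillatory integrals with polynomial phase\<close>

lemma poly_bounded_away_at_top:
  fixes p :: "real poly"
  assumes "p \<noteq> 0"
  obtains A c where "A \<ge> 0" "c > 0" "(\<forall>x\<ge>A. poly p x \<ge> c) \<or> (\<forall>x\<ge>A. poly p x \<le> - c)"
proof (cases "lead_coeff p > 0")
  case True
  then obtain n where "\<forall>x\<ge>n. poly p x \<ge> lead_coeff p" using poly_pinfty_gt_lc by blast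
  then show ?thesis using True by (intro that[of "max n 0" "lead_coeff p"]) auto
next
  case False
  with assms have "lead_coeff (- p) > 0"
    by (metis degree_minus coeff_minus leading_coeff_0_iff linorder_neqE_linordered_idom neg_0_less_iff_less)
  moreover from this obtain n where "\<forall>x\<ge>n. poly (- p) x \<ge> lead_coeff (- p)"
    using poly_pinfty_gt_lc by blast
  ultimately show ?thesis by (intro that[of "max n 0" "lead_coeff (-p)"]) (auto simp: le_minus_iff)
qed

text \<open>The zeros of the second derivative are confined to a bounded range below
  \<open>A\<close>, where the length of the interval is bound enough. Both \<open>A\<close> and
  \<open>c\<close> are read off the second derivative of \<open>p\<close>, which does not see
  \<open>z\<close>; hence the uniformity.\<close>

lemma oscillatory_integral_right_bound:
  fixes p :: "real poly"
  assumes "pderiv (pderiv p) \<noteq> 0"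
  obtains C where "\<And>z R. R \<ge> 0 \<Longrightarrow> norm (integral {0..R} (\<lambda>k. cis (z * k + poly p k))) \<le> C"
proof -
  obtain A c where A: "A \<ge> 0" and c: "c > 0"
    and sgn: "(\<forall>x\<ge>A. poly (pderiv (pderiv p)) x \<ge> c) \<or> (\<forall>x\<ge>A. poly (pderiv (pderiv p)) x \<le> - c)"
    using poly_bounded_away_at_top[OF assms] by blast
  have cont: "continuous_on S (\<lambda>k. cis (z * k + poly p k))" for z S
    by (intro continuous_intros)
  have tail: "norm (integral {A..R} (\<lambda>k. cis (z * k + poly p k))) \<le> 2 + 4 / c" if R: "R \<ge> A" for z R
    using sgn
  proof
    assume *: "\<forall>x\<ge>A. poly (pderiv (pderiv p)) x \<ge> c"
    show ?thesis
      using R c *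
      by (intro van_der_corput_second[where \<phi>' = "\<lambda>k. z + poly (pderiv p) k" and \<phi>'' = "poly (pderiv (pderiv p))"])
         (auto intro!: derivative_eq_intros continuous_intros)
  next
    assume *: "\<forall>x\<ge>A. poly (pderiv (pderiv p)) x \<le> - c"
    \<comment> \<open>The second-derivative test asks for a positive sign. Negating the phase
      conjugates the integral and keeps its norm.\<close>
    have "norm (integral {A..R} (\<lambda>k. cis (- (z * k + poly p k)))) \<le> 2 + 4 / c"
      using R c *
      by (intro van_der_corput_second[where \<phi>' = "\<lambda>k. - (z + poly (pderiv p) k)" and \<phi>'' = "\<lambda>k. - poly (pderiv (pderiv p)) k"])
         (auto intro!: derivative_eq_intros continuous_intros simp: le_minus_iff)
    also have "integral {A..R} (\<lambda>k. cis (- (z * k + poly p k))) = cnj (integral {A..R} (\<lambda>k. cis (z * k + poly p k)))"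
      using integral_linear[OF integrable_continuous_interval[OF cont] bounded_linear_cnj, of A R z]
      by (simp add: o_def cis_cnj)
    finally show ?thesis by simp
  qed
  show ?thesis
  proof (rule that[of "A + (2 + 4 / c)"])
    fix z R :: real assume R: "R \<ge> 0"
    show "norm (integral {0..R} (\<lambda>k. cis (z * k + poly p k))) \<le> A + (2 + 4 / c)"
    proof (cases "R \<le> A")
      case True
      have "0 < 4 / c" using c by simp
      moreover have "norm (integral {0..R} (\<lambda>k. cis (z * k + poly p k))) \<le> R - 0"
        using R by (intro norm_integral_cis_le continuous_intros)
      ultimately show ?thesis using True by linarith
    next
      case False
      have "integral {0..R} (\<lambda>k. cis (z * k + poly p k)) =
         integral {0..A} (\<lambda>k. cis (z * k + poly p k)) + integral {A..R} (\<lambda>k. cis (z * k + poly p k))"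
        using A False cont by (intro Henstock_Kurzweil_Integration.integral_combine[symmetric]
            integrable_continuous_interval) auto
      also have "norm \<dots> \<le> norm (integral {0..A} (\<lambda>k. cis (z * k + poly p k)))
          + norm (integral {A..R} (\<lambda>k. cis (z * k + poly p k)))"
        by (rule norm_triangle_ineq)
      also have "norm (integral {0..A} (\<lambda>k. cis (z * k + poly p k))) \<le> A - 0"
        using A by (intro norm_integral_cis_le continuous_intros)
      also have "norm (integral {A..R} (\<lambda>k. cis (z * k + poly p k))) \<le> 2 + 4 / c"
        using tail False by simp
      finally show ?thesis by simp
    qed
  qed
qed

proposition oscillatory_integral_bound:
  fixes p :: "real poly"
  assumes "degree p \<ge> 2"
  obtains C where "C \<ge> 0" "\<And>z R. norm (integral {-R..R} (\<lambda>k. cis (z * k + poly p k))) \<le> C"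
proof -
  \<comment> \<open>The negative half-axis is reflected onto the positive one. This changes
    \<open>p k\<close> into \<open>p (- k)\<close>, of the same degree, and \<open>z\<close> into
    \<open>- z\<close>, which is harmless because the bounds hold for all \<open>z\<close>.\<close>
  define p' where "p' = p \<circ>\<^sub>p [:0, -1:]"
  have dd: "pderiv (pderiv r) \<noteq> 0" if "degree r \<ge> 2" for r :: "real poly"
  proof
    assume "pderiv (pderiv r) = 0"
    then have "degree (pderiv r) = 0" by (simp add: pderiv_eq_0_iff)
    then show False using that by (simp add: degree_pderiv)
  qed
  have "degree p' \<ge> 2" using assms by (simp add: p'_def degree_pcompose)
  then obtain C1 where C1: "\<And>z R. R \<ge> 0 \<Longrightarrow> norm (integral {0..R} (\<lambda>k. cis (z * k + poly p' k))) \<le> C1"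
    using oscillatory_integral_right_bound dd by metis
  obtain C2 where C2: "\<And>z R. R \<ge> 0 \<Longrightarrow> norm (integral {0..R} (\<lambda>k. cis (z * k + poly p k))) \<le> C2"
    using oscillatory_integral_right_bound[OF dd[OF assms]] by metis
  have nn: "C1 + C2 \<ge> 0" using C1[of 0 0] C2[of 0 0] by simp
  have "norm (integral {-R..R} (\<lambda>k. cis (z * k + poly p k))) \<le> C1 + C2" for z R
  proof (cases "R \<ge> 0")
    case True
    let ?f = "\<lambda>k. cis (z * k + poly p k)"
    have "integral {-R..R} ?f = integral {-R..0} ?f + integral {0..R} ?f"
      using True by (intro Henstock_Kurzweil_Integration.integral_combine[symmetric]
          integrable_continuous_interval continuous_intros) auto
    also have "integral {-R..0} ?f = integral {0..R} (\<lambda>k. ?f (- k))"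
      using Henstock_Kurzweil_Integration.integral_reflect_real[of 0 R ?f] 
        Henstock_Kurzweil_Integration.integral_reflect_real[of R 0 "\<lambda>k. ?f (-k)"] by simp
    also have "\<dots> = integral {0..R} (\<lambda>k. cis ((-z) * k + poly p' k))"
      by (simp add: p'_def poly_pcompose)
    finally have "norm (integral {-R..R} ?f) \<le> norm (integral {0..R} (\<lambda>k. cis ((-z) * k + poly p' k)))
         + norm (integral {0..R} ?f)"
      by (metis norm_triangle_ineq)
    then show ?thesis using C1[OF True, of "-z"] C2[OF True, of z] by linarith
  qed (use nn in auto)
  with nn show ?thesis by (rule that)
qed

subsection \<open>Continuity of translation in $L^1$\<close>

lemma lborel_integrable_translate:
  fixes f :: "real \<Rightarrow> 'a::{banach, second_countable_topology}"
  shows "integrable lborel f \<Longrightarrow> integrable lborel (\<lambda>x. f (x + h))"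
  using lborel_integrable_real_affine[of f 1 h] by (simp add: add.commute)

lemma lborel_integral_translate:
  fixes f :: "real \<Rightarrow> 'a::{banach, second_countable_topology}"
  shows "(LINT x|lborel. f (x + h)) = (LINT x|lborel. f x)"
  using lborel_integral_real_affine[of 1 f h] by (simp add: add.commute)

text \<open>The distance equals twice the measure of \<open>U\<close> minus twice the measure of its
  overlap with its translate. The overlap needs pointwise convergence only on \<open>U\<close>,
  where openness gives it; the boundary of \<open>U\<close>, possibly of positive measure, never
  enters.\<close>

lemma L1_translation_continuous_open:
  fixes U :: "real set"
  assumes "open U" "emeasure lborel U < \<infinity>" "X \<longlonglongrightarrow> 0"
  shows "(\<lambda>n. LINT x|lborel. \<bar>indicat_real U (x + X n) - indicator U x\<bar>) \<longlonglongrightarrow> 0"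
proof -
  have [measurable]: "U \<in> sets borel" using assms by auto
  have int: "integrable lborel (indicat_real U)" using assms by (simp add: integrable_indicator_iff)
  have intp: "integrable lborel (\<lambda>x. indicat_real U x * indicat_real U (x + h))" for h
    by (rule Bochner_Integration.integrable_bound[OF int]) (auto split: split_indicator)
  have "(\<lambda>n. LINT x|lborel. indicat_real U x * indicat_real U (x + X n))
      \<longlonglongrightarrow> (LINT x|lborel. indicat_real U x)"
  proof (rule integral_dominated_convergence[where w="indicat_real U"])
    show "AE x in lborel. (\<lambda>n. indicat_real U x * indicat_real U (x + X n)) \<longlonglongrightarrow> indicat_real U x"
    proof (intro AE_I2)
      fix x
      show "(\<lambda>n. indicat_real U x * indicat_real U (x + X n)) \<longlonglongrightarrow> indicat_real U x"
      proof (cases "x \<in> U")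
        case True
        have "(\<lambda>n. x + X n) \<longlonglongrightarrow> x" using tendsto_add[OF tendsto_const assms(3), of x] by simp
        then have "eventually (\<lambda>n. x + X n \<in> U) sequentially"
          using True \<open>open U\<close> by (simp add: tendsto_def)
        then have "eventually (\<lambda>n. indicat_real U x * indicat_real U (x + X n) = indicat_real U x) sequentially"
          by eventually_elim (use True in simp)
        then show ?thesis by (rule tendsto_eventually)
      qed simp
    qed
  qed (use int in \<open>auto split: split_indicator\<close>)
  then have "(\<lambda>n. 2 * (LINT x|lborel. indicat_real U x) - 2 * (LINT x|lborel. indicat_real U x * indicat_real U (x + X n)))
      \<longlonglongrightarrow> 2 * (LINT x|lborel. indicat_real U x) - 2 * (LINT x|lborel. indicat_real U x)"
    by (intro tendsto_intros)
  moreover have "(LINT x|lborel. \<bar>indicat_real U (x + h) - indicator U x\<bar>) =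
     2 * (LINT x|lborel. indicat_real U x) - 2 * (LINT x|lborel. indicat_real U x * indicat_real U (x + h))" for h
  proof -
    have "(LINT x|lborel. \<bar>indicat_real U (x + h) - indicator U x\<bar>) =
       (LINT x|lborel. indicat_real U (x + h) + indicat_real U x - 2 * (indicat_real U x * indicat_real U (x + h)))"
      by (intro Bochner_Integration.integral_cong) (auto split: split_indicator)
    also have "\<dots> = 2 * (LINT x|lborel. indicat_real U x) - 2 * (LINT x|lborel. indicat_real U x * indicat_real U (x + h))"
      using int intp[of h] lborel_integrable_translate[OF int, of h]
      by (simp add: lborel_integral_translate)
    finally show ?thesis .
  qed
  ultimately show ?thesis by simp
qed

text \<open>The modulus of translation of \<open>f\<close> exceeds that of \<open>g\<close> by at most $2\|f-g\|_1$, so the property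
  passes to $L^1$-limits.\<close>

lemma L1_translation_continuous_approx:
  fixes f :: "real \<Rightarrow> 'a::{banach, second_countable_topology}"
  assumes f: "integrable lborel f"
    and approx: "\<And>e. e > 0 \<Longrightarrow> \<exists>g. integrable lborel g \<and> (LINT x|lborel. norm (f x - g x)) < e \<and>
       (\<lambda>n. LINT x|lborel. norm (g (x + X n) - g x)) \<longlonglongrightarrow> 0"
  shows "(\<lambda>n. LINT x|lborel. norm (f (x + X n) - f x)) \<longlonglongrightarrow> 0"
proof (rule LIMSEQ_I)
  fix e :: real assume "e > 0"
  then obtain g where g: "integrable lborel g" "(LINT x|lborel. norm (f x - g x)) < e / 3"
    "(\<lambda>n. LINT x|lborel. norm (g (x + X n) - g x)) \<longlonglongrightarrow> 0"
    using approx[of "e / 3"] by auto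
  from LIMSEQ_D[OF g(3), of "e / 3"] \<open>e > 0\<close>
  obtain N where N: "\<And>n. n \<ge> N \<Longrightarrow> norm (LINT x|lborel. norm (g (x + X n) - g x)) < e / 3" by auto
  have "norm (LINT x|lborel. norm (f (x + X n) - f x)) < e" if n: "n \<ge> N" for n
  proof -
    note int = f g(1) lborel_integrable_translate[OF f, of "X n"] lborel_integrable_translate[OF g(1), of "X n"]
    have "(LINT x|lborel. norm (f (x + X n) - f x)) \<le>
      (LINT x|lborel. norm (f (x + X n) - g (x + X n)) + norm (g (x + X n) - g x) + norm (f x - g x))"
    proof (intro integral_mono)
      fix x
      have "f (x + X n) - f x = (f (x + X n) - g (x + X n)) + (g (x + X n) - g x) + - (f x - g x)" by simp
      then show "norm (f (x + X n) - f x) \<le> norm (f (x + X n) - g (x + X n)) + norm (g (x + X n) - g x) + norm (f x - g x)"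
        using norm_triangle_ineq[of "f (x + X n) - g (x + X n)" "g (x + X n) - g x"]
          norm_triangle_ineq4[of "(f (x + X n) - g (x + X n)) + (g (x + X n) - g x)" "f x - g x"] by simp
    qed (use int in auto)
    also have "\<dots> = (LINT x|lborel. norm (f (x + X n) - g (x + X n))) + (LINT x|lborel. norm (g (x + X n) - g x))
       + (LINT x|lborel. norm (f x - g x))"
      using int by (subst Bochner_Integration.integral_add; simp)+
    also have "(LINT x|lborel. norm (f (x + X n) - g (x + X n))) = (LINT x|lborel. norm (f x - g x))"
      by (rule lborel_integral_translate[of "\<lambda>x. norm (f x - g x)"])
    finally have "(LINT x|lborel. norm (f (x + X n) - f x)) < e / 3 + e / 3 + e / 3"
      using g(2) N[OF n] by auto
    then show ?thesis by simp
  qed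
  then show "\<exists>no. \<forall>n\<ge>no. norm ((LINT x|lborel. norm (f (x + X n) - f x)) - 0) < e" by auto
qed

proposition L1_translation_continuous:
  fixes f :: "real \<Rightarrow> 'a::{banach, second_countable_topology}"
  assumes "integrable lborel f" "X \<longlonglongrightarrow> 0"
  shows "(\<lambda>n. LINT x|lborel. norm (f (x + X n) - f x)) \<longlonglongrightarrow> 0"
  using assms(1)
proof induction
  case (base A c)
  have [measurable]: "A \<in> sets borel" using base by simp
  have ind: "(\<lambda>n. LINT x|lborel. norm (indicat_real A (x + X n) - indicat_real A x)) \<longlonglongrightarrow> 0"
  proof (rule L1_translation_continuous_approx)
    show "integrable lborel (indicat_real A)" using base by (simp add: integrable_indicator_iff)
    fix e :: real assume "e > 0"
    \<comment> \<open>Outer regularity brings an arbitrary measurable set within L1-distance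
      \<open>e\<close> of an open one.\<close>
    then obtain U where U: "open U" "A \<subseteq> U" "emeasure lborel (U - A) < e"
      using outer_regular_lborel[of A e] by auto
    have [measurable]: "U \<in> sets borel" using U by auto
    have "emeasure lborel U \<le> emeasure lborel A + emeasure lborel (U - A)"
      using emeasure_subadditive[of A lborel "U - A"] U(2) by (simp add: Un_absorb1)
    also have "\<dots> < \<infinity>" using base U(3) by (simp add: less_top[symmetric]) (metis ennreal_less_top order_less_trans top.not_eq_extremum)
    finally have fin: "emeasure lborel U < \<infinity>" .
    have "(LINT x|lborel. norm (indicat_real A x - indicat_real U x)) = (LINT x|lborel. indicat_real (U - A) x)"
      using U(2) by (intro Bochner_Integration.integral_cong) (auto split: split_indicator)
    also have "\<dots> = measure lborel (U - A)" by simp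
    also have "\<dots> < e"
      using U(3) \<open>e > 0\<close> unfolding measure_def
      by (simp add: less_trans[OF U(3) ennreal_less_top] enn2real_less_iff)
    finally show "\<exists>g. integrable lborel g \<and> (LINT x|lborel. norm (indicat_real A x - g x)) < e \<and>
       (\<lambda>n. LINT x|lborel. norm (g (x + X n) - g x)) \<longlonglongrightarrow> 0"
      using L1_translation_continuous_open[OF U(1) fin assms(2)] fin
      by (intro exI[of _ "indicat_real U"]) (simp add: integrable_indicator_iff)
  qed
  have "norm (indicat_real A (x + X n) *\<^sub>R c - indicat_real A x *\<^sub>R c) =
      norm (indicat_real A (x + X n) - indicat_real A x) * norm c" for x n
    by (metis norm_scaleR real_norm_def scaleR_left_diff_distrib)
  then show ?case using tendsto_mult_right[OF ind, of "norm c"] by simp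
next
  case (add f g)
  let ?F = "\<lambda>f n. LINT x|lborel. norm (f (x + X n) - f x)"
  show ?case
  proof (rule Lim_null_comparison[OF always_eventually])
    show "\<forall>n. norm (?F (\<lambda>x. f x + g x) n) \<le> ?F f n + ?F g n"
    proof
      fix n
      note int = add.hyps lborel_integrable_translate[OF add.hyps(1), of "X n"]
        lborel_integrable_translate[OF add.hyps(2), of "X n"]
      have "?F (\<lambda>x. f x + g x) n \<le> (LINT x|lborel. norm (f (x + X n) - f x) + norm (g (x + X n) - g x))"
        using int by (intro integral_mono) (auto simp: norm_diff_triangle_ineq)
      also have "\<dots> = ?F f n + ?F g n"
        using int by (intro Bochner_Integration.integral_add) auto
      finally show "norm (?F (\<lambda>x. f x + g x) n) \<le> ?F f n + ?F g n" by simp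
    qed
    show "(\<lambda>n. ?F f n + ?F g n) \<longlonglongrightarrow> 0"
      using tendsto_add[OF add.IH] by simp
  qed
next
  case (lim f s)
  show ?case
  proof (rule L1_translation_continuous_approx[OF lim.hyps(4)])
    fix e :: real assume "e > 0"
    have "(\<lambda>i. LINT x|lborel. norm (f x - s i x)) \<longlonglongrightarrow> (LINT (x::real)|lborel. (0::real))"
    \<comment> \<open>The induction rule supplies approximants with norm at most
      \<open>2 * norm (f x)\<close>, so the difference to \<open>f\<close> is at most 3 times
      \<open>norm (f x)\<close>.\<close>
    proof (rule integral_dominated_convergence[where w="\<lambda>x. 3 * norm (f x)"])
      show "AE x in lborel. (\<lambda>i. norm (f x - s i x)) \<longlonglongrightarrow> 0"
      proof (intro AE_I2)
        fix x :: real
        have "(\<lambda>i. f x - s i x) \<longlonglongrightarrow> f x - f x"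
          using lim.hyps(2)[of x] by (intro tendsto_intros) simp
        then show "(\<lambda>i. norm (f x - s i x)) \<longlonglongrightarrow> 0" by (simp add: tendsto_norm_zero)
      qed
      fix i show "AE x in lborel. norm (norm (f x - s i x)) \<le> 3 * norm (f x)"
      proof (intro AE_I2)
        fix x :: real
        show "norm (norm (f x - s i x)) \<le> 3 * norm (f x)"
          using lim.hyps(3)[of x i] norm_triangle_ineq4[of "f x" "s i x"] by simp
      qed
    qed (use lim.hyps in auto)
    then obtain i where "(LINT x|lborel. norm (f x - s i x)) < e"
      using LIMSEQ_D[of _ _ e] \<open>e > 0\<close> by fastforce
    then show "\<exists>g. integrable lborel g \<and> (LINT x|lborel. norm (f x - g x)) < e \<and>
       (\<lambda>n. LINT x|lborel. norm (g (x + X n) - g x)) \<longlonglongrightarrow> 0"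
      using lim.hyps lim.IH by blast
  qed
qed

text \<open>Bridge from the completed measure of the statement to \<open>lborel\<close>, on which
  the Fubini arguments run. Fourier transforms, L2 distances and interval averages do not notice the
  change on a null set.\<close>

lemma lebesgue_integrable_borel_rep:
  fixes f :: "real \<Rightarrow> complex"
  assumes "integrable lebesgue f"
  obtains f' where "integrable lborel f'" "AE x in lebesgue. f x = f' x"
proof -
  have m: "(\<lambda>x. Re (f x)) \<in> borel_measurable lebesgue" "(\<lambda>x. Im (f x)) \<in> borel_measurable lebesgue"
    using assms by auto
  obtain u where u: "u \<in> borel_measurable lborel" "AE x in lborel. Re (f x) = u x"
    using completion_ex_borel_measurable_real[OF m(1)] by auto
  obtain v where v: "v \<in> borel_measurable lborel" "AE x in lborel. Im (f x) = v x"
    using completion_ex_borel_measurable_real[OF m(2)] by auto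
  define f' where "f' x = Complex (u x) (v x)" for x
  have f'[measurable]: "f' \<in> borel_measurable lborel"
    unfolding f'_def Complex_eq using u v by simp
  have "AE x in lborel. f x = f' x"
    using u(2) v(2) by eventually_elim (simp add: f'_def complex_eq_iff)
  then have ae: "AE x in lebesgue. f x = f' x" by (rule AE_completion)
  moreover have "integrable lebesgue f'"
    by (rule integrable_cong_AE_imp[OF assms]) (use ae measurable_completion[OF f'] in auto)
  then have "integrable lborel f'" using integrable_completion[OF f'] by simp
  ultimately show ?thesis using that by blast
qed

subsection \<open>The Fourier transform of an $L^2$ inverse transform\<close>

lemma borel_measurable_cis[measurable]: "cis \<in> borel_measurable borel"
  by (intro borel_measurable_continuous_onI continuous_intros)

text \<open>Justifies the exchanges of integrals below. In each of them \<open>u\<close> is cut off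
  to a bounded interval; the cut-off supplies the absolute integrability that an oscillating kernel
  of constant modulus cannot provide.\<close>

lemma integrable_pair_bounded_kernel:
  fixes f u :: "real \<Rightarrow> complex" and K :: "real \<Rightarrow> real \<Rightarrow> complex"
  assumes f: "integrable lborel f" and u: "integrable lborel u"
    and K[measurable]: "(\<lambda>(x, y). K x y) \<in> borel_measurable (lborel \<Otimes>\<^sub>M lborel)"
    and bound: "\<And>x y. norm (K x y) \<le> C"
  shows "integrable (lborel \<Otimes>\<^sub>M lborel) (\<lambda>(x, y). f x * u y * K x y)"
proof (rule lborel_pair.Fubini_integrable)
  note [measurable] = borel_measurable_integrable[OF f] borel_measurable_integrable[OF u]
  show meas[measurable]: "(\<lambda>(x, y). f x * u y * K x y) \<in> borel_measurable (lborel \<Otimes>\<^sub>M lborel)"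
    by measurable
  have bd: "norm (f x * u y * K x y) \<le> norm (norm (f x) * C * norm (u y))" for x y
  proof -
    have "norm (f x * u y * K x y) = (norm (f x) * norm (u y)) * norm (K x y)" by (simp add: norm_mult)
    also have "\<dots> \<le> (norm (f x) * norm (u y)) * C" by (intro mult_left_mono bound) simp
    also have "\<dots> \<le> norm (norm (f x) * C * norm (u y))" by (simp add: mult_ac)
    finally show ?thesis .
  qed
  have int: "integrable lborel (\<lambda>y. f x * u y * K x y)" for x
    by (rule Bochner_Integration.integrable_bound[of _ "\<lambda>y. norm (f x) * C * norm (u y)"])
       (use u bd in \<open>auto intro!: AE_I2\<close>)
  then show "AE x in lborel. integrable lborel (\<lambda>y. case (x, y) of (x, y) \<Rightarrow> f x * u y * K x y)" by simp
  have "norm (LINT y|lborel. norm (f x * u y * K x y)) \<le> norm (C * (LINT y|lborel. norm (u y)) * norm (f x))" for x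
  proof -
    have "(LINT y|lborel. norm (f x * u y * K x y)) \<le> (LINT y|lborel. norm (f x) * C * norm (u y))"
      using int[of x] u bd bound[THEN order_trans[OF norm_ge_zero]]
      by (intro integral_mono) (auto simp: abs_mult)
    also have "\<dots> = C * (LINT y|lborel. norm (u y)) * norm (f x)" by simp
    finally show ?thesis by (simp add: integral_nonneg_AE)
  qed
  then have "AE x in lborel. norm (LINT y|lborel. norm (f x * u y * K x y)) \<le> norm (C * (LINT y|lborel. norm (u y)) * norm (f x))"
    by (intro AE_I2)
  moreover have "integrable lborel (\<lambda>x. C * (LINT y|lborel. norm (u y)) * norm (f x))"
    using f by simp
  moreover have "(\<lambda>x. LINT y|lborel. norm (f x * u y * K x y)) \<in> borel_measurable lborel"
    by measurable
  ultimately show "integrable lborel (\<lambda>x. LINT y|lborel. norm (case (x, y) of (x, y) \<Rightarrow> f x * u y * K x y))"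
    unfolding prod.case by (rule Bochner_Integration.integrable_bound[rotated 2])
qed

lemma integrable_mult_bounded:
  fixes f K :: "real \<Rightarrow> complex"
  assumes f: "integrable lborel f" and [measurable]: "K \<in> borel_measurable lborel"
    and bound: "\<And>x. norm (K x) \<le> C"
  shows "integrable lborel (\<lambda>x. f x * K x)"
proof (rule Bochner_Integration.integrable_bound)
  show "integrable lborel (\<lambda>x. C * norm (f x))" using f by simp
  have "norm (f x * K x) \<le> norm (C * norm (f x))" for x
    using mult_left_mono[OF bound[of x], of "norm (f x)"] by (simp add: norm_mult mult_ac)
  then show "AE x in lborel. norm (f x * K x) \<le> norm (C * norm (f x))" by simp
qed (use f in measurable)

text \<open>A rescaled characteristic function of the standard normal law. The result is written
  again as a normal density, so that it can act as an approximate identity of width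
  \<open>\<sigma>\<close>.\<close>

lemma gaussian_fourier:
  assumes "\<sigma> > 0"
  shows "(LINT x|lborel. cis (t * x) * std_normal_density (\<sigma> * x)) =
    of_real (sqrt (2 * pi) / \<sigma> * std_normal_density (t / \<sigma>))"
proof -
  have "of_real (exp (- ((t / \<sigma>)\<^sup>2) / 2)) = char std_normal_distribution (t / \<sigma>)"
    by (simp add: char_std_normal_distribution)
  also have "\<dots> = (LINT x|lborel. std_normal_density x *\<^sub>R cis (t / \<sigma> * x))"
    unfolding char_def by (subst integral_density) (auto simp: cis_conv_exp)
  also have "\<dots> = \<sigma> *\<^sub>R (LINT x|lborel. std_normal_density (\<sigma> * x) *\<^sub>R cis (t * x))"
    using assms by (subst lborel_integral_real_affine[of \<sigma> _ 0]) auto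
  also have "(LINT x|lborel. std_normal_density (\<sigma> * x) *\<^sub>R cis (t * x)) =
      (LINT x|lborel. cis (t * x) * std_normal_density (\<sigma> * x))"
    by (simp add: scaleR_conv_of_real mult.commute)
  finally have "(LINT x|lborel. cis (t * x) * std_normal_density (\<sigma> * x)) =
      of_real (exp (- ((t / \<sigma>)\<^sup>2) / 2)) / of_real \<sigma>"
    using assms by (simp add: scaleR_conv_of_real eq_divide_eq mult.commute)
  also have "\<dots> = of_real (sqrt (2 * pi) / \<sigma> * std_normal_density (t / \<sigma>))"
    by (simp add: std_normal_density_def)
  finally show ?thesis .
qed

text \<open>Two computations of one limit. The L2 convergence passes to integrals against
  \<open>\<phi>\<close>, which is square integrable because it is bounded and integrable. For finite
  \<open>R\<close>, Fubini moves the transform onto \<open>\<phi>\<close>, and then boundedness of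
  \<open>F\<close> and integrability of the transform of \<open>\<phi>\<close> allow
  \<open>R\<close> to tend to infinity.\<close>

lemma fourier_testing:
  fixes F g \<phi> :: "real \<Rightarrow> complex"
  assumes F[measurable]: "F \<in> borel_measurable lborel" and FB: "\<And>k. norm (F k) \<le> B"
    and g: "integrable lborel g"
    and lim: "((\<lambda>R. \<integral>\<^sup>+x. ennreal ((cmod (g x - 1 / (2 * of_real pi) *
          (LINT k:{-R..R}|lborel. cis (k * x) * F k)))\<^sup>2) \<partial>lborel) \<longlongrightarrow> 0) at_top"
    and \<phi>: "integrable lborel \<phi>" and \<phi>b: "\<And>x. norm (\<phi> x) \<le> 1"
    and \<Phi>: "integrable lborel (\<lambda>k. LINT x|lborel. cis (k * x) * \<phi> x)"
  shows "(LINT x|lborel. g x * \<phi> x) = 1 / (2 * of_real pi) * (LINT k|lborel. F k * (LINT x|lborel. cis (k * x) * \<phi> x))"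
proof -
  note [measurable] = borel_measurable_integrable[OF g] borel_measurable_integrable[OF \<phi>]
  define \<Phi>' where "\<Phi>' k = (LINT x|lborel. cis (k * x) * \<phi> x)" for k
  have \<Phi>'[measurable]: "\<Phi>' \<in> borel_measurable lborel"
    using borel_measurable_integrable[OF \<Phi>] unfolding \<Phi>'_def .
  define h where "h R x = 1 / (2 * of_real pi) * (LINT k:{-R..R}|lborel. cis (k * x) * F k)" for R x
  have [measurable]: "h R \<in> borel_measurable lborel" for R
    unfolding h_def set_lebesgue_integral_def by measurable
  have B: "B \<ge> 0" using FB[of 0] norm_ge_zero order_trans by blast
  have iI: "integrable lborel (indicat_real {-R..R})" for R :: real
    by (rule integrable_real_indicator) (auto simp: emeasure_lborel_Icc_eq)
  have iF: "integrable lborel (\<lambda>k. indicat_real {-R..R} k *\<^sub>R F k)" for R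
    by (rule Bochner_Integration.integrable_bound[of _ "\<lambda>k. B * indicat_real {-R..R} k"])
      (use FB B iI in \<open>auto intro!: AE_I2 split: split_indicator\<close>)
  have pair: "integrable (lborel \<Otimes>\<^sub>M lborel) (\<lambda>(x, k). \<phi> x * (indicat_real {-R..R} k *\<^sub>R F k) * cis (k * x))" for R
    by (rule integrable_pair_bounded_kernel[OF \<phi> iF, where C=1]) auto
  have h_eq: "h R x * \<phi> x = 1 / (2 * of_real pi) * (LINT k|lborel. \<phi> x * (indicat_real {-R..R} k *\<^sub>R F k) * cis (k * x))" for R x
  proof -
    have "(LINT k|lborel. \<phi> x * (indicat_real {-R..R} k *\<^sub>R F k) * cis (k * x)) =
        (LINT k|lborel. \<phi> x * (indicat_real {-R..R} k *\<^sub>R (cis (k * x) * F k)))"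
      by (intro Bochner_Integration.integral_cong refl) (simp add: mult.assoc mult.commute[of "F _"])
    also have "\<dots> = \<phi> x * (LINT k|lborel. indicat_real {-R..R} k *\<^sub>R (cis (k * x) * F k))"
      by (rule integral_mult_right_zero)
    finally show ?thesis by (simp add: h_def set_lebesgue_integral_def)
  qed
  have ih: "integrable lborel (\<lambda>x. h R x * \<phi> x)" for R
    unfolding h_eq by (rule integrable_mult_right, rule lborel_pair.integrable_fst[OF pair])
  have h\<phi>: "(LINT x|lborel. h R x * \<phi> x) = 1 / (2 * of_real pi) * (LINT k|lborel. indicat_real {-R..R} k *\<^sub>R (F k * \<Phi>' k))" for R
  proof -
    have "(LINT x|lborel. h R x * \<phi> x) = 1 / (2 * of_real pi) *
       (LINT x|lborel. LINT k|lborel. \<phi> x * (indicat_real {-R..R} k *\<^sub>R F k) * cis (k * x))"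
      unfolding h_eq by simp
    also have "(LINT x|lborel. LINT k|lborel. \<phi> x * (indicat_real {-R..R} k *\<^sub>R F k) * cis (k * x)) =
       (LINT k|lborel. LINT x|lborel. \<phi> x * (indicat_real {-R..R} k *\<^sub>R F k) * cis (k * x))"
      by (rule lborel_pair.Fubini_integral[symmetric, OF pair])
    also have "\<dots> = (LINT k|lborel. indicat_real {-R..R} k *\<^sub>R (F k * \<Phi>' k))"
    proof (intro Bochner_Integration.integral_cong refl)
      fix k
      have "(LINT x|lborel. \<phi> x * (indicat_real {-R..R} k *\<^sub>R F k) * cis (k * x)) =
        (LINT x|lborel. (indicat_real {-R..R} k *\<^sub>R F k) * (cis (k * x) * \<phi> x))"
        by (simp add: mult_ac)
      then show "(LINT x|lborel. \<phi> x * (indicat_real {-R..R} k *\<^sub>R F k) * cis (k * x)) = indicat_real {-R..R} k *\<^sub>R (F k * \<Phi>' k)"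
        by (simp add: \<Phi>'_def)
    qed
    finally show ?thesis .
  qed
  have "((\<lambda>R. LINT k|lborel. indicat_real {-R..R} k *\<^sub>R (F k * \<Phi>' k)) \<longlongrightarrow> (LINT k|lborel. F k * \<Phi>' k)) at_top"
  proof (rule integral_dominated_convergence_at_top)
    show "integrable lborel (\<lambda>k. B * norm (\<Phi>' k))" using \<Phi> unfolding \<Phi>'_def by simp
    have bd: "norm (F k * \<Phi>' k) \<le> B * norm (\<Phi>' k)" for k
      using FB by (simp add: norm_mult mult_right_mono)
    then show "\<forall>\<^sub>F R in at_top. AE k in lborel. norm (indicat_real {-R..R} k *\<^sub>R (F k * \<Phi>' k)) \<le> B * norm (\<Phi>' k)"
      using B by (intro always_eventually allI AE_I2) (auto split: split_indicator)
    show "AE k in lborel. ((\<lambda>R. indicat_real {-R..R} k *\<^sub>R (F k * \<Phi>' k)) \<longlongrightarrow> F k * \<Phi>' k) at_top"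
    proof (intro AE_I2 tendsto_eventually)
      fix k
      show "\<forall>\<^sub>F R in at_top. indicat_real {-R..R} k *\<^sub>R (F k * \<Phi>' k) = F k * \<Phi>' k"
        using eventually_ge_at_top[of "\<bar>k\<bar>"] by eventually_elim (auto simp: abs_le_iff)
    qed
  qed (measurable)
  then have L1: "((\<lambda>R. LINT x|lborel. h R x * \<phi> x) \<longlongrightarrow> 1 / (2 * of_real pi) * (LINT k|lborel. F k * \<Phi>' k)) at_top"
    unfolding h\<phi> by (intro tendsto_mult_left)
  have i\<phi>: "integrable lborel (\<lambda>x. norm (\<phi> x) ^ 2)"
    by (rule Bochner_Integration.integrable_bound[OF \<phi>])
       (use \<phi>b in \<open>auto intro!: AE_I2 simp: power2_eq_square mult_left_le\<close>)
  define M where "M = (LINT x|lborel. norm (\<phi> x) ^ 2)"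
  have M: "M \<ge> 0" by (simp add: M_def)
  have L2: "((\<lambda>R. LINT x|lborel. h R x * \<phi> x) \<longlongrightarrow> (LINT x|lborel. g x * \<phi> x)) at_top"
  proof (rule tendstoI)
    fix e :: real assume e: "e > 0"
    \<comment> \<open>Instead of Cauchy-Schwarz, the product is split by the weighted inequality uv
      <= u^2/(2d) + d v^2/2. With the squared distance below \<open>d * d\<close> this gives
      \<open>d * (1 + M) / 2\<close>, that is, \<open>e / 2\<close>; the 1 covers
      \<open>M = 0\<close>.\<close>
    define d where "d = e / (1 + M)"
    have d: "d > 0" using e M by (simp add: d_def)
    have "\<forall>\<^sub>F R in at_top. (\<integral>\<^sup>+x. ennreal ((cmod (g x - h R x))\<^sup>2) \<partial>lborel) < ennreal (d * d)"
      using order_tendstoD(2)[OF lim, of "ennreal (d * d)"] d unfolding h_def by simp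
    then show "\<forall>\<^sub>F R in at_top. dist (LINT x|lborel. h R x * \<phi> x) (LINT x|lborel. g x * \<phi> x) < e"
    proof eventually_elim
      case (elim R)
      have fin: "(\<integral>\<^sup>+x. ennreal ((cmod (g x - h R x))\<^sup>2) \<partial>lborel) < \<infinity>"
        using less_trans[OF elim ennreal_less_top] by simp
      have i2: "integrable lborel (\<lambda>x. (cmod (g x - h R x))\<^sup>2)"
        by (intro integrableI_bounded) (use fin in auto)
      have "ennreal (LINT x|lborel. (cmod (g x - h R x))\<^sup>2) < ennreal (d * d)"
        using elim i2 by (subst nn_integral_eq_integral[symmetric]) auto
      then have le: "(LINT x|lborel. (cmod (g x - h R x))\<^sup>2) < d * d" 
        by (simp add: ennreal_less_iff)
      have ig: "integrable lborel (\<lambda>x. g x * \<phi> x)" using g \<phi>b by (intro integrable_mult_bounded[where C=1]) auto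
      have "dist (LINT x|lborel. h R x * \<phi> x) (LINT x|lborel. g x * \<phi> x) = norm (LINT x|lborel. (g x - h R x) * \<phi> x)"
        using ih[of R] ig by (simp add: dist_norm norm_minus_commute left_diff_distrib)
      also have "\<dots> \<le> (LINT x|lborel. norm ((g x - h R x) * \<phi> x))"
        by (rule integral_norm_bound)
      also have "\<dots> \<le> (LINT x|lborel. (cmod (g x - h R x))\<^sup>2 / (2 * d) + d / 2 * norm (\<phi> x) ^ 2)"
      proof (intro integral_mono)
        show "integrable lborel (\<lambda>x. norm ((g x - h R x) * \<phi> x))"
          using ih[of R] ig by (simp add: left_diff_distrib)
        fix x
        have n: "norm ((g x - h R x) * \<phi> x) = cmod (g x - h R x) * norm (\<phi> x)" by (rule norm_mult)
        have "0 \<le> (cmod (g x - h R x) - d * norm (\<phi> x))\<^sup>2 / (2 * d)" using d by simp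
        also have "\<dots> = (cmod (g x - h R x))\<^sup>2 / (2 * d) + d / 2 * norm (\<phi> x) ^ 2 - norm ((g x - h R x) * \<phi> x)"
          unfolding n using d by (simp add: power2_eq_square field_simps)
        finally show "norm ((g x - h R x) * \<phi> x) \<le> (cmod (g x - h R x))\<^sup>2 / (2 * d) + d / 2 * norm (\<phi> x) ^ 2" by simp
      qed (use i2 i\<phi> in auto)
      also have "\<dots> = (LINT x|lborel. (cmod (g x - h R x))\<^sup>2) / (2 * d) + d / 2 * M"
        unfolding M_def using i2 i\<phi> by simp
      also have "\<dots> \<le> (d * d) / (2 * d) + d / 2 * M"
        using le d by (intro add_right_mono divide_right_mono) auto
      also have "\<dots> = d * (1 + M) / 2" using d by (simp add: field_simps)
      also have "d * (1 + M) = e" using M by (simp add: d_def)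
      also have "e / 2 < e" using e by simp
      finally show ?case .
    qed
  qed
  show ?thesis
    using tendsto_unique[OF _ L2 L1] unfolding \<Phi>'_def by simp
qed

text \<open>Testing the $L^2$ limit against modulated Gaussians, whose widths then tend to infinity, identifies
  the Fourier transform of \<open>g\<close> pointwise without Plancherel's theorem.\<close>

proposition fourier_of_L2_inverse_fourier:
  fixes F g :: "real \<Rightarrow> complex"
  assumes F: "continuous_on UNIV F" and FB: "\<And>k. norm (F k) \<le> B"
    and g: "integrable lborel g"
    and lim: "((\<lambda>R. \<integral>\<^sup>+x. ennreal ((cmod (g x - 1 / (2 * of_real pi) *
          (LINT k:{-R..R}|lborel. cis (k * x) * F k)))\<^sup>2) \<partial>lborel) \<longlongrightarrow> 0) at_top"
  shows "(LINT x|lborel. cis (- (\<xi> * x)) * g x) = F \<xi>"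
proof -
  have Fm[measurable]: "F \<in> borel_measurable lborel"
    using borel_measurable_continuous_onI[OF F] by simp
  note [measurable] = borel_measurable_integrable[OF g]
  \<comment> \<open>The factor \<open>sqrt (2 * pi)\<close> normalizes the Gaussian to 1 at the
    origin: the wide Gaussians stay below 1 and tend to 1 pointwise.\<close>
  have N1: "sqrt (2 * pi) * std_normal_density y \<le> 1" for y
    by (simp add: std_normal_density_def)
  \<comment> \<open>The transform of the modulated Gaussian is a bump of mass \<open>2 * pi\<close>
    and width \<open>\<sigma>\<close> centred at \<open>\<xi>\<close>; the mass cancels the
    prefactor of the inversion integral. As \<open>\<sigma>\<close> tends to 0, the left side
    becomes the Fourier integral of \<open>g\<close>, and continuity of \<open>F\<close> turns the
    right side into \<open>F \<xi>\<close>.\<close>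
  have key: "(LINT x|lborel. g x * (cis (- (\<xi> * x)) * of_real (sqrt (2 * pi) * std_normal_density (\<sigma> * x)))) =
     (LINT s|lborel. F (\<xi> + \<sigma> * s) * of_real (std_normal_density s))" if \<sigma>: "\<sigma> > 0" for \<sigma>
  proof -
    define \<phi> where "\<phi> x = cis (- (\<xi> * x)) * of_real (sqrt (2 * pi) * std_normal_density (\<sigma> * x))" for x
    have iN: "integrable lborel (\<lambda>x. std_normal_density (a + c * x))" if "c \<noteq> 0" for a c
      using lborel_integrable_real_affine[OF integrable_normal_density[OF zero_less_one] that] .
    have \<phi>: "integrable lborel \<phi>"
      using integrable_mult_bounded[of "\<lambda>x. complex_of_real (sqrt (2 * pi) * std_normal_density (\<sigma> * x))" "\<lambda>x. cis (- (\<xi> * x))" 1]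
        iN[of \<sigma> 0] \<sigma> unfolding \<phi>_def by (simp add: mult_ac)
    have b: "norm (\<phi> x) \<le> 1" for x
      using N1 by (simp add: \<phi>_def norm_mult del: of_real_mult)
    have \<Phi>: "(LINT x|lborel. cis (k * x) * \<phi> x) = of_real (2 * pi / \<sigma> * std_normal_density ((k - \<xi>) / \<sigma>))" for k
    proof -
      have "(LINT x|lborel. cis (k * x) * \<phi> x) =
         (LINT x|lborel. of_real (sqrt (2 * pi)) * (cis ((k - \<xi>) * x) * of_real (std_normal_density (\<sigma> * x))))"
      proof (intro Bochner_Integration.integral_cong refl)
        fix x
        have "cis ((k - \<xi>) * x) = cis (k * x) * cis (- (\<xi> * x))"
          by (simp add: cis_mult left_diff_distrib)
        then show "cis (k * x) * \<phi> x = of_real (sqrt (2 * pi)) * (cis ((k - \<xi>) * x) * of_real (std_normal_density (\<sigma> * x)))"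
          by (simp add: \<phi>_def)
      qed
      also have "\<dots> = of_real (sqrt (2 * pi)) * of_real (sqrt (2 * pi) / \<sigma> * std_normal_density ((k - \<xi>) / \<sigma>))"
        unfolding gaussian_fourier[OF \<sigma>, symmetric] by simp
      also have "\<dots> = of_real (sqrt (2 * pi) * (sqrt (2 * pi) / \<sigma> * std_normal_density ((k - \<xi>) / \<sigma>)))"
        by (rule of_real_mult[symmetric])
      also have "sqrt (2 * pi) * (sqrt (2 * pi) / \<sigma> * std_normal_density ((k - \<xi>) / \<sigma>)) =
          2 * pi / \<sigma> * std_normal_density ((k - \<xi>) / \<sigma>)"
        using real_sqrt_mult_self[of "2 * pi"] by (simp flip: mult.assoc)
      finally show ?thesis .
    qed
    have i\<Phi>: "integrable lborel (\<lambda>k. LINT x|lborel. cis (k * x) * \<phi> x)"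
      unfolding \<Phi> using iN[of "1 / \<sigma>" "- \<xi> / \<sigma>"] \<sigma> by (simp add: diff_divide_distrib)
    have "(LINT x|lborel. g x * \<phi> x) = 1 / (2 * of_real pi) * (LINT k|lborel. F k * (LINT x|lborel. cis (k * x) * \<phi> x))"
      by (rule fourier_testing[OF Fm FB g lim \<phi> b i\<Phi>])
    also have "\<dots> = (LINT k|lborel. F k * of_real (1 / \<sigma> * std_normal_density ((k - \<xi>) / \<sigma>)))"
      unfolding \<Phi> by (subst integral_mult_right_zero[symmetric]) (simp add: field_simps)
    also have "\<dots> = \<sigma> *\<^sub>R (LINT s|lborel. F (\<xi> + \<sigma> * s) * of_real (1 / \<sigma> * std_normal_density s))"
      using \<sigma> by (subst lborel_integral_real_affine[of \<sigma> _ \<xi>]) auto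
    also have "\<dots> = (LINT s|lborel. F (\<xi> + \<sigma> * s) * of_real (std_normal_density s))"
      using \<sigma> by (subst integral_scaleR_right[symmetric]) (simp add: scaleR_conv_of_real)
    finally show ?thesis unfolding \<phi>_def .
  qed
  have s0: "(\<lambda>n. inverse (real (Suc n))) \<longlonglongrightarrow> 0" by (rule LIMSEQ_inverse_real_of_nat)
  have "(\<lambda>n. LINT s|lborel. F (\<xi> + inverse (real (Suc n)) * s) * of_real (std_normal_density s))
      \<longlonglongrightarrow> (LINT s|lborel. F \<xi> * of_real (std_normal_density s))"
  proof (rule integral_dominated_convergence[where w="\<lambda>s. B * std_normal_density s"])
    show "AE s in lborel. (\<lambda>n. F (\<xi> + inverse (real (Suc n)) * s) * of_real (std_normal_density s)) \<longlonglongrightarrow> F \<xi> * of_real (std_normal_density s)"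
    proof (intro AE_I2 tendsto_mult_right)
      fix s
      have "isCont F \<xi>" using F by (simp add: continuous_on_eq_continuous_at)
      moreover have "(\<lambda>n. \<xi> + inverse (real (Suc n)) * s) \<longlonglongrightarrow> \<xi>"
        using tendsto_add[OF tendsto_const tendsto_mult_left_zero[OF s0], of \<xi> s] by simp
      ultimately show "(\<lambda>n. F (\<xi> + inverse (real (Suc n)) * s)) \<longlonglongrightarrow> F \<xi>" by (rule isCont_tendsto_compose)
    qed
    show "AE s in lborel. norm (F (\<xi> + inverse (real (Suc n)) * s) * of_real (std_normal_density s)) \<le> B * std_normal_density s" for n
      using FB by (intro AE_I2) (simp add: norm_mult mult_right_mono)
  qed auto
  moreover have "(LINT s|lborel. F \<xi> * complex_of_real (std_normal_density s)) = F \<xi>"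
    by simp
  ultimately have R: "(\<lambda>n. LINT s|lborel. F (\<xi> + inverse (real (Suc n)) * s) * of_real (std_normal_density s)) \<longlonglongrightarrow> F \<xi>"
    by simp
  have "(\<lambda>n. LINT x|lborel. g x * (cis (- (\<xi> * x)) * of_real (sqrt (2 * pi) * std_normal_density (inverse (real (Suc n)) * x))))
      \<longlonglongrightarrow> (LINT x|lborel. g x * (cis (- (\<xi> * x)) * of_real 1))"
  proof (rule integral_dominated_convergence[where w="\<lambda>x. norm (g x)"])
    show "AE x in lborel. (\<lambda>n. g x * (cis (- (\<xi> * x)) * of_real (sqrt (2 * pi) * std_normal_density (inverse (real (Suc n)) * x))))
        \<longlonglongrightarrow> g x * (cis (- (\<xi> * x)) * of_real 1)"
    proof (intro AE_I2 tendsto_mult_left tendsto_of_real)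
      fix x :: real
      have "(\<lambda>n. exp (- ((inverse (real (Suc n)) * x)\<^sup>2) / 2)) \<longlonglongrightarrow> exp (- ((0 * x)\<^sup>2) / 2)"
        by (intro tendsto_intros s0) auto
      then show "(\<lambda>n. sqrt (2 * pi) * std_normal_density (inverse (real (Suc n)) * x)) \<longlonglongrightarrow> 1"
        by (simp add: std_normal_density_def)
    qed
    show "AE x in lborel. norm (g x * (cis (- (\<xi> * x)) * of_real (sqrt (2 * pi) * std_normal_density (inverse (real (Suc n)) * x)))) \<le> norm (g x)" for n
      using N1 by (intro AE_I2) (simp add: norm_mult mult_left_le del: of_real_mult)
  qed (use g in auto)
  moreover have "(LINT x|lborel. g x * (cis (- (\<xi> * x)) * of_real (sqrt (2 * pi) * std_normal_density (inverse (real (Suc n)) * x)))) =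
     (LINT s|lborel. F (\<xi> + inverse (real (Suc n)) * s) * of_real (std_normal_density s))" for n
    by (rule key) simp
  ultimately show ?thesis
    using LIMSEQ_unique[OF R] by (simp add: mult.commute)
qed

subsection \<open>Fourier inversion of interval averages\<close>

text \<open>A truncated unimodular multiplier acts as convolution with an explicit kernel.
  \<open>P = 0\<close> gives the Dirichlet kernel behind Fourier inversion, a polynomial
  \<open>P\<close> the dispersive kernel.\<close>

lemma fourier_multiplier_truncated:
  fixes g :: "real \<Rightarrow> complex" and P :: "real \<Rightarrow> real"
  assumes g: "integrable lborel g" and P[measurable]: "P \<in> borel_measurable borel"
  shows "(LINT k:{-R..R}|lborel. cis (k * x) * (cis (P k) * (LINT y|lborel. cis (- (k * y)) * g y))) =
    (LINT y|lborel. g y * (LINT k:{-R..R}|lborel. cis ((x - y) * k + P k)))"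
proof -
  note [measurable] = borel_measurable_integrable[OF g]
  have "integrable lborel (indicat_real {-R..R})"
    by (rule integrable_real_indicator) (auto simp: emeasure_lborel_Icc_eq)
  then have u: "integrable lborel (\<lambda>k. complex_of_real (indicat_real {-R..R} k))" by simp
  let ?G = "\<lambda>y k. g y * complex_of_real (indicat_real {-R..R} k) * cis ((x - y) * k + P k)"
  have pair: "integrable (lborel \<Otimes>\<^sub>M lborel) (\<lambda>(y, k). ?G y k)"
    by (rule integrable_pair_bounded_kernel[OF g u, where C=1]) auto
  have "(LINT k:{-R..R}|lborel. cis (k * x) * (cis (P k) * (LINT y|lborel. cis (- (k * y)) * g y))) =
     (LINT k|lborel. LINT y|lborel. ?G y k)"
    unfolding set_lebesgue_integral_def
  proof (intro Bochner_Integration.integral_cong refl)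
    fix k
    have "?G y k = (of_real (indicat_real {-R..R} k) * cis (k * x) * cis (P k)) * (cis (- (k * y)) * g y)" for y
    proof -
      have "cis ((x - y) * k + P k) = cis (k * x) * cis (P k) * cis (- (k * y))"
        by (simp add: cis_mult algebra_simps)
      then show ?thesis by simp
    qed
    then have "(LINT y|lborel. ?G y k) =
       (LINT y|lborel. (of_real (indicat_real {-R..R} k) * cis (k * x) * cis (P k)) * (cis (- (k * y)) * g y))"
      by (intro Bochner_Integration.integral_cong refl)
    also have "\<dots> = (of_real (indicat_real {-R..R} k) * cis (k * x) * cis (P k)) * (LINT y|lborel. cis (- (k * y)) * g y)"
      by (rule integral_mult_right_zero)
    finally show "indicat_real {-R..R} k *\<^sub>R (cis (k * x) * (cis (P k) * (LINT y|lborel. cis (- (k * y)) * g y))) =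
        (LINT y|lborel. ?G y k)"
      by (simp add: scaleR_conv_of_real mult.assoc)
  qed
  also have "\<dots> = (LINT y|lborel. LINT k|lborel. ?G y k)"
    by (rule lborel_pair.Fubini_integral[OF pair])
  also have "\<dots> = (LINT y|lborel. g y * (LINT k:{-R..R}|lborel. cis ((x - y) * k + P k)))"
    unfolding set_lebesgue_integral_def
    by (intro Bochner_Integration.integral_cong refl)
       (simp add: mult.assoc scaleR_conv_of_real flip: integral_mult_right_zero)
  finally show ?thesis .
qed

lemma dirichlet_kernel_sinc:
  fixes \<theta> R :: real
  assumes "R \<ge> 0"
  shows "(LINT k:{-R..R}|lborel. cis (\<theta> * k)) = of_real (2 * R * sinc (R * \<theta>))"
proof -
  have "set_integrable lborel {-R..R} (\<lambda>k. cis (\<theta> * k))"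
    by (intro borel_integrable_atLeastAtMost' continuous_intros)
  then have "(LINT k:{-R..R}|lborel. cis (\<theta> * k)) = integral {-R..R} (\<lambda>k. cis (\<theta> * k))"
    by (rule set_borel_integral_eq_integral)
  also have "\<dots> = of_real (2 * R * sinc (R * \<theta>))"
  proof (cases "\<theta> = 0")
    case True
    then show ?thesis using assms by (simp add: scaleR_conv_of_real)
  next
    case False
    have "((\<lambda>k. cis (\<theta> * k)) has_integral (cis (\<theta> * R) / (\<i> * \<theta>) - cis (\<theta> * (-R)) / (\<i> * \<theta>))) {-R..R}"
    proof (rule fundamental_theorem_of_calculus)
      fix k assume "k \<in> {-R..R}"
      have "((\<lambda>k. cis (\<theta> * k)) has_vector_derivative (\<theta> *\<^sub>R (\<i> * cis (\<theta> * k)))) (at k within {-R..R})"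
        unfolding has_vector_derivative_def
        by (auto intro!: derivative_eq_intros simp: mult.commute)
      then have "((\<lambda>k. cis (\<theta> * k) / (\<i> * \<theta>)) has_vector_derivative (\<theta> *\<^sub>R (\<i> * cis (\<theta> * k))) / (\<i> * \<theta>)) (at k within {-R..R})"
        by (rule has_vector_derivative_divide)
      then show "((\<lambda>k. cis (\<theta> * k) / (\<i> * \<theta>)) has_vector_derivative cis (\<theta> * k)) (at k within {-R..R})"
        using False by (simp add: scaleR_conv_of_real)
    qed (use assms in simp)
    then have "integral {-R..R} (\<lambda>k. cis (\<theta> * k)) = (cis (\<theta> * R) - cis (- (\<theta> * R))) / (\<i> * \<theta>)"
      by (simp add: integral_unique diff_divide_distrib)
    also have "cis (\<theta> * R) - cis (- (\<theta> * R)) = 2 * \<i> * of_real (sin (\<theta> * R))"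
      by (simp add: complex_eq_iff)
    finally show ?thesis
      using False by (cases "R = 0") (auto simp: field_simps)
  qed
  finally show ?thesis .
qed

lemma abs_sinc_le_1: "\<bar>sinc x\<bar> \<le> 1"
  using abs_sin_x_le_abs_x[of x] by (auto simp: divide_le_eq_1)

lemma integral_sinc_Si:
  assumes "a \<le> b"
  shows "(LINT x:{a..b}|lborel. R * sinc (R * (x - y))) = Si (R * (b - y)) - Si (R * (a - y))"
proof -
  have "set_integrable lborel {a..b} (\<lambda>x. R * sinc (R * (x - y)))"
    by (intro borel_integrable_atLeastAtMost' continuous_intros)
  then have "(LINT x:{a..b}|lborel. R * sinc (R * (x - y))) = integral {a..b} (\<lambda>x. R * sinc (R * (x - y)))"
    by (rule set_borel_integral_eq_integral)
  also have "((\<lambda>x. R * sinc (R * (x - y))) has_integral (Si (R * (b - y)) - Si (R * (a - y)))) {a..b}"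
  proof (rule fundamental_theorem_of_calculus[OF assms])
    fix x assume "x \<in> {a..b}"
    have "((\<lambda>x. Si (R * (x - y))) has_real_derivative sinc (R * (x - y)) * R) (at x)"
      by (rule DERIV_chain2[OF DERIV_Si]) (auto intro!: derivative_eq_intros)
    then show "((\<lambda>x. Si (R * (x - y))) has_vector_derivative R * sinc (R * (x - y))) (at x within {a..b})"
      by (simp add: has_real_derivative_iff_has_vector_derivative mult.commute has_vector_derivative_at_within)
  qed
  then have "integral {a..b} (\<lambda>x. R * sinc (R * (x - y))) = Si (R * (b - y)) - Si (R * (a - y))"
    by (rule integral_unique)
  finally show ?thesis .
qed

lemma Si_scaled_limit:
  assumes "\<theta> \<noteq> 0"
  shows "((\<lambda>R. Si (R * \<theta>)) \<longlongrightarrow> sgn \<theta> * (pi / 2)) at_top"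
proof -
  have pos: "((\<lambda>R. Si (R * t)) \<longlongrightarrow> pi / 2) at_top" if "t > 0" for t
    by (rule filterlim_compose[OF Si_at_top])
      (use that in \<open>auto intro!: filterlim_at_top_mult_tendsto_pos[OF tendsto_const] filterlim_ident\<close>)
  show ?thesis
  proof (cases "\<theta> > 0")
    case True then show ?thesis using pos by simp
  next
    case False
    with assms have "- \<theta> > 0" by simp
    from tendsto_minus[OF pos[OF this]]
    have "((\<lambda>R. - Si (R * - \<theta>)) \<longlongrightarrow> sgn \<theta> * (pi / 2)) at_top" using False assms by (simp add: sgn_if)
    moreover have "\<forall>\<^sub>F R in at_top. - Si (R * - \<theta>) = Si (R * \<theta>)"
      using eventually_ge_at_top[of 0]
    proof eventually_elim
      case (elim R)
      then show ?case using Si_neg[of "R * - \<theta>"] \<open>- \<theta> > 0\<close> 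
        by (metis minus_minus mult_minus_right mult_nonneg_nonneg order_less_imp_le)
    qed
    ultimately show ?thesis by (rule Lim_transform_eventually)
  qed
qed

text \<open>Integrating the truncated inversion formula over an interval turns the Dirichlet kernel into a
  bounded difference of sine integrals, so no regularity of \<open>f\<close> is needed.\<close>

proposition fourier_inversion_interval:
  fixes f :: "real \<Rightarrow> complex"
  assumes f: "integrable lborel f" and ab: "a \<le> b"
  shows "((\<lambda>R. LINT x:{a..b}|lborel. 1 / (2 * of_real pi) *
      (LINT k:{-R..R}|lborel. cis (k * x) * (LINT y|lborel. cis (- (k * y)) * f y)))
    \<longlongrightarrow> (LINT x:{a..b}|lborel. f x)) at_top"
proof -
  note [measurable] = borel_measurable_integrable[OF f]
  define \<psi> where "\<psi> R y = (Si (R * (b - y)) - Si (R * (a - y))) / pi" for R y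
  obtain B where B: "\<And>T. \<bar>Si T\<bar> \<le> B" using bounded_Si by blast
  have "integrable lborel (indicat_real {a..b})"
    by (rule integrable_real_indicator) (auto simp: emeasure_lborel_Icc_eq)
  then have u: "integrable lborel (\<lambda>k. complex_of_real (indicat_real {a..b} k))" by simp
  have eq: "(LINT x:{a..b}|lborel. 1 / (2 * of_real pi) *
      (LINT k:{-R..R}|lborel. cis (k * x) * (LINT y|lborel. cis (- (k * y)) * f y))) =
      (LINT y|lborel. f y * of_real (\<psi> R y))" if R: "R \<ge> 0" for R
  proof -
    let ?G = "\<lambda>y x. f y * complex_of_real (indicat_real {a..b} x) * complex_of_real (R * sinc (R * (x - y)) / pi)"
    have inner: "1 / (2 * of_real pi) * (LINT k:{-R..R}|lborel. cis (k * x) * (LINT y|lborel. cis (- (k * y)) * f y))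
       = (LINT y|lborel. f y * of_real (R * sinc (R * (x - y)) / pi))" for x
    proof -
      have "(LINT k:{-R..R}|lborel. cis (k * x) * (LINT y|lborel. cis (- (k * y)) * f y)) =
        (LINT y|lborel. f y * of_real (2 * R * sinc (R * (x - y))))"
        using fourier_multiplier_truncated[OF f, of "\<lambda>_. 0" R x] dirichlet_kernel_sinc[OF R] by simp
      then have "1 / (2 * of_real pi) * (LINT k:{-R..R}|lborel. cis (k * x) * (LINT y|lborel. cis (- (k * y)) * f y)) =
        1 / (2 * of_real pi) * (LINT y|lborel. f y * of_real (2 * R * sinc (R * (x - y))))"
        by (rule arg_cong)
      also have "\<dots> = (LINT y|lborel. 1 / (2 * of_real pi) * (f y * of_real (2 * R * sinc (R * (x - y)))))"
        by (rule integral_mult_right_zero[symmetric])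
      also have "\<dots> = (LINT y|lborel. f y * of_real (R * sinc (R * (x - y)) / pi))"
        by (intro Bochner_Integration.integral_cong refl) (simp add: field_simps)
      finally show ?thesis .
    qed
    have "(LINT x:{a..b}|lborel. 1 / (2 * of_real pi) *
      (LINT k:{-R..R}|lborel. cis (k * x) * (LINT y|lborel. cis (- (k * y)) * f y))) = (LINT x|lborel. LINT y|lborel. ?G y x)"
      unfolding inner unfolding set_lebesgue_integral_def
    proof (intro Bochner_Integration.integral_cong refl)
      fix x
      have "indicat_real {a..b} x *\<^sub>R (LINT y|lborel. f y * complex_of_real (R * sinc (R * (x - y)) / pi)) =
          (LINT y|lborel. indicat_real {a..b} x *\<^sub>R (f y * complex_of_real (R * sinc (R * (x - y)) / pi)))"
        by (rule integral_scaleR_right[symmetric])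
      also have "\<dots> = (LINT y|lborel. ?G y x)"
        by (intro Bochner_Integration.integral_cong refl) (simp add: scaleR_conv_of_real)
      finally show "indicat_real {a..b} x *\<^sub>R (LINT y|lborel. f y * complex_of_real (R * sinc (R * (x - y)) / pi)) =
          (LINT y|lborel. ?G y x)" .
    qed
    also have "\<dots> = (LINT y|lborel. LINT x|lborel. ?G y x)"
    \<comment> \<open>At fixed \<open>R\<close> the crude bound \<open>R / pi\<close> suffices for
      the exchange; a bound uniform in \<open>R\<close> appears only after the integration over
      \<open>x\<close>.\<close>
    proof (rule lborel_pair.Fubini_integral, rule integrable_pair_bounded_kernel[OF f u])
      fix x y
      have "R * \<bar>sinc (R * (y - x))\<bar> / pi \<le> R * 1 / pi"
        by (intro divide_right_mono mult_left_mono abs_sinc_le_1 R) simp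
      then show "norm (complex_of_real (R * sinc (R * (y - x)) / pi)) \<le> R / pi"
        using R unfolding norm_of_real abs_divide abs_mult by simp
    qed measurable
    also have "\<dots> = (LINT y|lborel. f y * of_real (\<psi> R y))"
    proof (intro Bochner_Integration.integral_cong refl)
      fix y
      have "(LINT x|lborel. ?G y x) = (LINT x|lborel. f y * complex_of_real (indicat_real {a..b} x *\<^sub>R (R * sinc (R * (x - y))) / pi))"
        by (simp add: mult.assoc)
      also have "\<dots> = f y * of_real ((LINT x:{a..b}|lborel. R * sinc (R * (x - y))) / pi)"
        unfolding set_lebesgue_integral_def integral_mult_right_zero integral_complex_of_real integral_divide_zero ..
      finally show "(LINT x|lborel. ?G y x) = f y * of_real (\<psi> R y)"
        unfolding \<psi>_def integral_sinc_Si[OF ab] .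
    qed
    finally show ?thesis .
  qed
  have "((\<lambda>R. LINT y|lborel. f y * of_real (\<psi> R y)) \<longlongrightarrow> (LINT y|lborel. indicat_real {a..b} y *\<^sub>R f y)) at_top"
  proof (rule integral_dominated_convergence_at_top)
    show "integrable lborel (\<lambda>y. norm (f y) * ((B + B) / pi))" using f by simp
    have "\<bar>\<psi> R y\<bar> \<le> (B + B) / pi" for R y
      using B[of "R * (b - y)"] B[of "R * (a - y)"] unfolding \<psi>_def abs_divide
      by (intro frac_le) auto
    then have "norm (f y * of_real (\<psi> R y)) \<le> norm (f y) * ((B + B) / pi)" for R y
      unfolding norm_mult norm_of_real by (intro mult_left_mono norm_ge_zero)
    then show "\<forall>\<^sub>F R in at_top. AE y in lborel. norm (f y * of_real (\<psi> R y)) \<le> norm (f y) * ((B + B) / pi)"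
      by (intro always_eventually allI AE_I2)
    show "AE y in lborel. ((\<lambda>R. f y * of_real (\<psi> R y)) \<longlongrightarrow> indicat_real {a..b} y *\<^sub>R f y) at_top"
      \<comment> \<open>At the endpoints one sine integral stays at 0, and for \<open>a < b\<close>
        the limit is 1/2 instead of the indicator, so the two points are discarded.\<close>
      using AE_lborel_singleton[of a] AE_lborel_singleton[of b]
    proof eventually_elim
      case (elim y)
      have "((\<lambda>R. \<psi> R y) \<longlongrightarrow> (sgn (b - y) * (pi / 2) - sgn (a - y) * (pi / 2)) / pi) at_top"
        unfolding \<psi>_def using elim by (intro tendsto_intros Si_scaled_limit) auto
      also have "(sgn (b - y) * (pi / 2) - sgn (a - y) * (pi / 2)) / pi = indicat_real {a..b} y"
        using elim ab by (auto simp: sgn_if indicator_def)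
      finally have "((\<lambda>R. f y * of_real (\<psi> R y)) \<longlongrightarrow> f y * of_real (indicat_real {a..b} y)) at_top"
        by (intro tendsto_intros)
      then show ?case by (simp add: scaleR_conv_of_real mult.commute)
    qed
    show "(\<lambda>y. f y * of_real (\<psi> R y)) \<in> borel_measurable lborel" for R
      unfolding \<psi>_def by measurable
  qed measurable
  then have "((\<lambda>R. LINT y|lborel. f y * of_real (\<psi> R y)) \<longlongrightarrow> (LINT x:{a..b}|lborel. f x)) at_top"
    by (simp add: set_lebesgue_integral_def)
  moreover have "\<forall>\<^sub>F R in at_top. (LINT y|lborel. f y * of_real (\<psi> R y)) = (LINT x:{a..b}|lborel. 1 / (2 * of_real pi) *
      (LINT k:{-R..R}|lborel. cis (k * x) * (LINT y|lborel. cis (- (k * y)) * f y)))"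
    using eventually_ge_at_top[of 0] by eventually_elim (rule eq[symmetric])
  ultimately show ?thesis by (rule Lim_transform_eventually)
qed

section \<open>Equicontinuity of the truncated backward evolution\<close>

lemma norm_set_integral_le:
  fixes f :: "real \<Rightarrow> complex"
  assumes "a \<le> b" and [measurable]: "f \<in> borel_measurable borel" and bound: "\<And>x. norm (f x) \<le> M"
  shows "set_integrable lborel {a..b} f" "norm (LINT x:{a..b}|lborel. f x) \<le> (b - a) * M"
proof -
  have i: "integrable lborel (\<lambda>x. M * indicat_real {a..b} x)"
    by (intro integrable_mult_right integrable_real_indicator) (auto simp: emeasure_lborel_Icc_eq)
  have le: "norm (indicat_real {a..b} x *\<^sub>R f x) \<le> M * indicat_real {a..b} x" for x
    using bound by (auto split: split_indicator)
  show int: "set_integrable lborel {a..b} f"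
    unfolding set_integrable_def
    by (rule Bochner_Integration.integrable_bound[OF i]) (use le order_trans[OF _ abs_ge_self] in auto)
  have "norm (LINT x:{a..b}|lborel. f x) \<le> (LINT x|lborel. norm (indicat_real {a..b} x *\<^sub>R f x))"
    unfolding set_lebesgue_integral_def by (rule integral_norm_bound)
  also have "\<dots> \<le> (LINT x|lborel. M * indicat_real {a..b} x)"
    using int i le unfolding set_integrable_def by (intro integral_mono integrable_norm)
  also have "\<dots> = (b - a) * M" using \<open>a \<le> b\<close> by simp
  finally show "norm (LINT x:{a..b}|lborel. f x) \<le> (b - a) * M" .
qed

lemma set_integral_translate:
  fixes f :: "real \<Rightarrow> complex"
  shows "(LINT s:{a + h..b + h}|lborel. f s) = (LINT s:{a..b}|lborel. f (s + h))"
proof -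
  have "indicat_real {a + h..b + h} (s + h) = indicat_real {a..b} s" for s by (simp add: indicator_def)
  then show ?thesis
    unfolding set_lebesgue_integral_def
    using lborel_integral_translate[of "\<lambda>s. indicat_real {a + h..b + h} s *\<^sub>R f s" h] by simp
qed

text \<open>With \<open>f\<close> and \<open>g\<close> the solution at times \<open>0\<close> and \<open>t\<close>: the truncated evolution kernels are
  uniformly bounded, so dispersion maps the $L^1$ modulus of continuity of \<open>g\<close> to a uniform modulus
  of continuity of \<open>f\<close>, here expressed through interval averages.\<close>

proposition dispersive_modulus_of_continuity:
  fixes f g :: "real \<Rightarrow> complex" and p :: "real poly"
  assumes f: "integrable lborel f" and g: "integrable lborel g"
    and eq: "\<And>k. (LINT y|lborel. cis (- (k * y)) * f y) = cis (poly p k) * (LINT y|lborel. cis (- (k * y)) * g y)"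
    and deg: "degree p \<ge> 2"
  obtains C where "\<And>a b h. a \<le> b \<Longrightarrow>
    norm ((LINT s:{a + h..b + h}|lborel. f s) - (LINT s:{a..b}|lborel. f s))
      \<le> (b - a) * (C * (LINT y|lborel. norm (g (y + h) - g y)))"
proof -
  note [measurable] = borel_measurable_integrable[OF f] borel_measurable_integrable[OF g]
  have pm[measurable]: "poly p \<in> borel_measurable borel"
    by (intro borel_measurable_continuous_onI continuous_intros)
  obtain C where C: "C \<ge> 0" and kbound: "\<And>z R. norm (integral {-R..R} (\<lambda>k. cis (z * k + poly p k))) \<le> C"
    using oscillatory_integral_bound[OF deg] by metis
  define K where "K R z = (LINT k:{-R..R}|lborel. cis (z * k + poly p k))" for R z
  have Km[measurable]: "K R \<in> borel_measurable borel" for R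
    unfolding K_def set_lebesgue_integral_def by measurable
  have KC: "norm (K R z) \<le> C" for R z
  proof -
    have "set_integrable lborel {-R..R} (\<lambda>k. cis (z * k + poly p k))"
      by (intro borel_integrable_atLeastAtMost' continuous_intros)
    then show ?thesis unfolding K_def using kbound by (simp add: set_borel_integral_eq_integral)
  qed
  \<comment> \<open>\<open>H R\<close> has two faces: by definition it is the truncated inversion of
    \<open>f\<close>, which identifies its limit, and by \<open>eq\<close> it is a convolution of
    \<open>g\<close> with \<open>K R\<close>, which gives its estimates.\<close>
  define H where "H R x = 1 / (2 * of_real pi) *
      (LINT k:{-R..R}|lborel. cis (k * x) * (LINT y|lborel. cis (- (k * y)) * f y))" for R x
  have HK: "H R x = 1 / (2 * of_real pi) * (LINT y|lborel. g y * K R (x - y))" for R x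
    unfolding H_def eq fourier_multiplier_truncated[OF g pm] K_def ..
  have Hm[measurable]: "H R \<in> borel_measurable borel" for R
    unfolding HK by measurable
  have igK: "integrable lborel (\<lambda>y. g y * K R (x - y))" if "integrable lborel g" for g R x
    by (rule integrable_mult_bounded[OF that _ KC]) measurable
  have conv_bound: "norm (LINT y|lborel. u y * K R (x - y)) \<le> C * (LINT y|lborel. norm (u y))"
    if u: "integrable lborel u" for u R x
  proof -
    have "norm (LINT y|lborel. u y * K R (x - y)) \<le> (LINT y|lborel. norm (u y * K R (x - y)))"
      by (rule integral_norm_bound)
    also have "\<dots> \<le> (LINT y|lborel. C * norm (u y))"
    proof (intro integral_mono integrable_norm igK u)
      show "norm (u y * K R (x - y)) \<le> C * norm (u y)" for y
        using mult_left_mono[OF KC, of "norm (u y)"] by (simp add: norm_mult mult.commute)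
    qed (use u in simp)
    finally show ?thesis by simp
  qed
  let ?C = "C / (2 * pi)"
  have scale: "norm (1 / (2 * of_real pi) * z :: complex) \<le> ?C * M" if "norm z \<le> C * M" for z M
    using divide_right_mono[OF that, of "2 * pi"] by (simp add: norm_mult norm_divide)
  have Hbound: "norm (H R x) \<le> ?C * (LINT y|lborel. norm (g y))" for R x
    unfolding HK by (rule scale[OF conv_bound[OF g]])
  have Hdiff: "norm (H R (x + h) - H R x) \<le> ?C * (LINT y|lborel. norm (g (y + h) - g y))" for R x h
  proof -
    have gh: "integrable lborel (\<lambda>y. g (y + h))" by (rule lborel_integrable_translate[OF g])
    \<comment> \<open>The shift is moved from the kernel to \<open>g\<close>: of \<open>K R\<close>
      only the size is controlled uniformly in \<open>R\<close>, while \<open>g\<close> has a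
      modulus of continuity in L1.\<close>
    have "(LINT y|lborel. g y * K R (x + h - y)) = (LINT y|lborel. g (y + h) * K R (x - y))"
      using lborel_integral_translate[of "\<lambda>y. g y * K R (x + h - y)" h] by simp
    then have "H R (x + h) - H R x = 1 / (2 * of_real pi) *
       ((LINT y|lborel. g (y + h) * K R (x - y)) - (LINT y|lborel. g y * K R (x - y)))"
      unfolding HK by (simp add: right_diff_distrib)
    also have "(LINT y|lborel. g (y + h) * K R (x - y)) - (LINT y|lborel. g y * K R (x - y)) =
        (LINT y|lborel. (g (y + h) - g y) * K R (x - y))"
      using igK[OF gh] igK[OF g] by (simp add: left_diff_distrib)
    finally show ?thesis using scale[OF conv_bound[of "\<lambda>y. g (y + h) - g y"]] g gh by simp
  qed
  show ?thesis
  proof (rule that)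
    fix a b h :: real assume ab: "a \<le> b"
    let ?D = "\<lambda>R. (LINT s:{a + h..b + h}|lborel. H R s) - (LINT s:{a..b}|lborel. H R s)"
    have "(?D \<longlongrightarrow> (LINT s:{a + h..b + h}|lborel. f s) - (LINT s:{a..b}|lborel. f s)) at_top"
      unfolding H_def using ab by (intro tendsto_diff fourier_inversion_interval f) auto
    moreover have "norm (?D R) \<le> (b - a) * (?C * (LINT y|lborel. norm (g (y + h) - g y)))" for R
    proof -
      have i: "set_integrable lborel {a..b} (\<lambda>s. H R (s + h))" "set_integrable lborel {a..b} (H R)"
        by (rule norm_set_integral_le[OF ab _ Hbound], measurable)+
      have "?D R = (LINT s:{a..b}|lborel. H R (s + h) - H R s)"
        unfolding set_integral_translate using set_integral_diff(2)[OF i] by simp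
      also have "norm \<dots> \<le> (b - a) * (?C * (LINT y|lborel. norm (g (y + h) - g y)))"
        by (rule norm_set_integral_le[OF ab _ Hdiff]) measurable
      finally show ?thesis .
    qed
    ultimately show "norm ((LINT s:{a + h..b + h}|lborel. f s) - (LINT s:{a..b}|lborel. f s))
      \<le> (b - a) * (?C * (LINT y|lborel. norm (g (y + h) - g y)))"
      by (intro tendsto_upperbound[OF tendsto_norm always_eventually]) auto
  qed
qed

subsection \<open>Jump discontinuities\<close>

lemma continuous_on_fourier_integral:
  fixes f :: "real \<Rightarrow> complex"
  assumes f: "integrable lborel f"
  shows "continuous_on UNIV (\<lambda>k. LINT y|lborel. cis (- (k * y)) * f y)"
  unfolding continuous_on_sequentially o_def
proof safe
  fix X and a :: real assume X: "X \<longlonglongrightarrow> a"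
  note [measurable] = borel_measurable_integrable[OF f]
  show "(\<lambda>n. LINT y|lborel. cis (- (X n * y)) * f y) \<longlonglongrightarrow> (LINT y|lborel. cis (- (a * y)) * f y)"
    by (rule integral_dominated_convergence[where w="\<lambda>y. norm (f y)"])
       (use f X in \<open>auto intro!: tendsto_intros simp: norm_mult\<close>)
qed

lemma norm_fourier_integral_le:
  fixes f :: "real \<Rightarrow> complex"
  shows "norm (LINT y|lborel. cis (- (k * y)) * f y) \<le> (LINT y|lborel. norm (f y))"
  using integral_norm_bound[of lborel "\<lambda>y. cis (- (k * y)) * f y"] by (simp add: norm_mult)

lemma fourier_borel_rep:
  assumes f: "integrable lborel f" and q: "integrable lebesgue q0" and ae: "AE x in lebesgue. q0 x = f x"
  shows "fourier q0 k = (LINT y|lborel. cis (- (k * y)) * f y)"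
proof -
  note [measurable] = borel_measurable_integrable[OF f]
  have m: "(\<lambda>y. cis (- (k * y)) * f y) \<in> borel_measurable lborel" by measurable
  have cm: "(\<lambda>y. cis (- (k * y))) \<in> borel_measurable lebesgue"
    by (rule measurable_completion) measurable
  have "fourier q0 k = (LINT y|lebesgue. cis (- (k * y)) * q0 y)"
    unfolding fourier_def by (intro Bochner_Integration.integral_cong refl) (simp add: cis_conv_exp mult.assoc)
  also have "\<dots> = (LINT y|lebesgue. cis (- (k * y)) * f y)"
  proof (rule integral_cong_AE)
    show "AE y in lebesgue. cis (- (k * y)) * q0 y = cis (- (k * y)) * f y"
      using ae by eventually_elim simp
  qed (use cm q measurable_completion[OF m] in \<open>auto intro!: borel_measurable_times\<close>)
  also have "\<dots> = (LINT y|lborel. cis (- (k * y)) * f y)"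
    by (rule integral_completion[OF m])
  finally show ?thesis .
qed

text \<open>\<open>T\<close> stands for \<open>Re\<close> or \<open>Im\<close>. Pulling it out of
  the integral exposes the complex interval average, to which the dispersive estimate
  applies.\<close>

lemma canonical_rep_borel_rep:
  fixes f q0 :: "real \<Rightarrow> complex" and T :: "complex \<Rightarrow> real"
  assumes f: "integrable lborel f" and q: "integrable lebesgue q0" and ae: "AE x in lebesgue. q0 x = f x"
    and T: "bounded_linear T"
  shows "canonical_rep (\<lambda>y. T (q0 y)) x =
    Limsup (at_right 0) (\<lambda>\<delta>. ereal (1 / (2 * \<delta>) * T (LINT y:{x - \<delta>..x + \<delta>}|lborel. f y)))"
proof -
  interpret T: bounded_linear T by (rule T)
  note [measurable] = borel_measurable_integrable[OF f]
  have Tm[measurable]: "T \<in> borel_measurable borel"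
    by (intro borel_measurable_continuous_onI T.continuous_on continuous_intros)
  have "(LINT y:{y. \<bar>y - x\<bar> < \<delta>}|lebesgue. T (q0 y)) = T (LINT y:{x - \<delta>..x + \<delta>}|lborel. f y)" for \<delta>
  proof -
    let ?I = "\<lambda>y. indicat_real {y. \<bar>y - x\<bar> < \<delta>} y *\<^sub>R T (f y)"
    have m: "?I \<in> borel_measurable lborel" by measurable
    have im: "indicat_real {y. \<bar>y - x\<bar> < \<delta>} \<in> borel_measurable lebesgue"
      by (rule measurable_completion) measurable
    have qm: "(\<lambda>y. T (q0 y)) \<in> borel_measurable lebesgue"
      by (rule measurable_compose[OF borel_measurable_integrable[OF q] Tm])
    have "(LINT y:{y. \<bar>y - x\<bar> < \<delta>}|lebesgue. T (q0 y)) = (LINT y|lebesgue. ?I y)"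
      unfolding set_lebesgue_integral_def
    proof (rule integral_cong_AE)
      show "AE y in lebesgue. indicat_real {y. \<bar>y - x\<bar> < \<delta>} y *\<^sub>R T (q0 y) = ?I y"
        using ae by eventually_elim simp
    qed (use im qm measurable_completion[OF m] in \<open>auto intro!: borel_measurable_scaleR\<close>)
    also have "\<dots> = (LINT y|lborel. ?I y)" by (rule integral_completion[OF m])
    also have "\<dots> = (LINT y|lborel. T (indicat_real {x - \<delta>..x + \<delta>} y *\<^sub>R f y))"
    proof (rule integral_cong_AE)
      show "AE y in lborel. ?I y = T (indicat_real {x - \<delta>..x + \<delta>} y *\<^sub>R f y)"
        using AE_lborel_singleton[of "x - \<delta>"] AE_lborel_singleton[of "x + \<delta>"]
        by eventually_elim (auto simp: T.scaleR T.zero indicator_def abs_less_iff)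
    qed measurable
    also have "\<dots> = T (LINT y:{x - \<delta>..x + \<delta>}|lborel. f y)"
      unfolding set_lebesgue_integral_def
      by (rule integral_bounded_linear[OF T integrable_mult_indicator[OF _ f]]) simp
    finally show ?thesis .
  qed
  then show ?thesis unfolding canonical_rep_def by simp
qed

lemma Limsup_at_right_shift_le:
  fixes A B :: "real \<Rightarrow> real"
  assumes "\<And>\<delta>. \<delta> > 0 \<Longrightarrow> A \<delta> \<le> B \<delta> + c"
  shows "Limsup (at_right 0) (\<lambda>\<delta>. ereal (A \<delta>)) \<le> Limsup (at_right 0) (\<lambda>\<delta>. ereal (B \<delta>)) + ereal c"
proof -
  have "Limsup (at_right 0) (\<lambda>\<delta>. ereal (A \<delta>)) \<le> Limsup (at_right 0) (\<lambda>\<delta>. ereal (B \<delta>) + ereal c)"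
    using assms by (intro Limsup_mono) (auto simp: eventually_at_filter)
  also have "\<dots> = Limsup (at_right 0) (\<lambda>\<delta>. ereal (B \<delta>)) + ereal c"
    by (rule Limsup_add_ereal_right) auto
  finally show ?thesis .
qed

text \<open>Points on the two sides of \<open>c\<close> at distance \<open>d n\<close> differ by the
  shift \<open>2 * d n\<close>, whose modulus tends to 0. The modulus is expressed by two additive
  inequalities because \<open>r\<close> may take infinite values, where a difference would be
  meaningless.\<close>

lemma one_sided_limits_agree:
  fixes r :: "real \<Rightarrow> ereal" and l u :: real
  assumes l: "(r \<longlongrightarrow> ereal l) (at_left c)" and u: "(r \<longlongrightarrow> ereal u) (at_right c)"
    and \<eta>: "\<And>x h. r (x + h) \<le> r x + ereal (\<eta> h)" "\<And>x h. r x \<le> r (x + h) + ereal (\<eta> h)"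
    and \<eta>0: "\<And>X. X \<longlonglongrightarrow> 0 \<Longrightarrow> (\<lambda>n. \<eta> (X n)) \<longlonglongrightarrow> 0"
  shows "l = u"
proof -
  define d where "d n = inverse (real (Suc n))" for n
  have d0: "d \<longlonglongrightarrow> 0" unfolding d_def by (rule LIMSEQ_inverse_real_of_nat)
  have dpos: "d n > 0" "d n \<noteq> 0" for n by (simp_all add: d_def del: of_nat_Suc)
  have L: "(\<lambda>n. r (c - d n)) \<longlonglongrightarrow> ereal l"
  proof (rule filterlim_compose[OF l])
    show "filterlim (\<lambda>n. c - d n) (at_left c) sequentially"
      using tendsto_diff[OF tendsto_const d0, of c] dpos by (auto simp: filterlim_at)
  qed
  have U: "(\<lambda>n. r (c + d n)) \<longlonglongrightarrow> ereal u"
  proof (rule filterlim_compose[OF u])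
    show "filterlim (\<lambda>n. c + d n) (at_right c) sequentially"
      using tendsto_add[OF tendsto_const d0, of c] dpos by (auto simp: filterlim_at)
  qed
  have "(\<lambda>n. \<eta> (2 * d n)) \<longlonglongrightarrow> 0" using tendsto_mult_right_zero[OF d0, of 2] by (rule \<eta>0)
  then have E: "(\<lambda>n. ereal (\<eta> (2 * d n))) \<longlonglongrightarrow> ereal 0" by simp
  have shift: "c - d n + 2 * d n = c + d n" for n by simp
  have "ereal u \<le> ereal l + ereal 0"
    using \<eta>(1)[of "c - d n" "2 * d n" for n, unfolded shift]
    by (intro LIMSEQ_le[OF U tendsto_add_ereal[OF _ _ L E]]) auto
  moreover have "ereal l \<le> ereal u + ereal 0"
    using \<eta>(2)[of "c - d n" "2 * d n" for n, unfolded shift]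
    by (intro LIMSEQ_le[OF L tendsto_add_ereal[OF _ _ U E]]) auto
  ultimately show ?thesis by simp
qed

theorem mainTheorem3:
  fixes n :: nat and w :: "nat \<Rightarrow> real"
    and q0 :: "real \<Rightarrow> complex" and q :: "real \<Rightarrow> real \<Rightarrow> complex"
  assumes "n \<ge> 2" and "w n \<noteq> 0"
    and "integrable lebesgue q0" and "square_integrable q0"
    and "\<And>t. t > 0 \<Longrightarrow> has_L2_inverse_fourier
           (\<lambda>k. exp (- (\<i> * of_real (dispersion n w k) * of_real t)) * fourier q0 k)
           (\<lambda>x. q x t)"
    and "\<exists>c. jump_discontinuity q0 c"
  shows "\<forall>t>0. \<not> integrable lebesgue (\<lambda>x. q x t)"
proof (intro allI impI notI)
  fix t :: real assume t: "t > 0" and int: "integrable lebesgue (\<lambda>x. q x t)"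
  obtain f where f: "integrable lborel f" and fae: "AE x in lebesgue. q0 x = f x"
    using lebesgue_integrable_borel_rep[OF assms(3)] by blast
  obtain g where g: "integrable lborel g" and gae: "AE x in lebesgue. q x t = g x"
    using lebesgue_integrable_borel_rep[OF int] by blast
  \<comment> \<open>The factor \<open>t\<close> is absorbed into the phase polynomial; since
    \<open>t > 0\<close>, its coefficient at \<open>n\<close> stays nonzero and the degree is at
    least 2.\<close>
  define p where "p = (\<Sum>j=2..n. monom (t * w j) j)"
  have p: "poly p k = t * dispersion n w k" for k
    by (simp add: p_def dispersion_def poly_sum poly_monom sum_distrib_left mult.assoc)
  have "coeff p n = t * w n"
    using \<open>n \<ge> 2\<close> by (simp add: p_def coeff_sum)
  then have deg: "degree p \<ge> 2"
    using t \<open>w n \<noteq> 0\<close> le_degree[of p n] \<open>n \<ge> 2\<close> by simp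
  define fhat where "fhat k = (LINT y|lborel. cis (- (k * y)) * f y)" for k
  define F where "F k = cis (- poly p k) * fhat k" for k
  have F_eq: "exp (- (\<i> * of_real (dispersion n w k) * of_real t)) * fourier q0 k = F k" for k
    unfolding F_def fhat_def fourier_borel_rep[OF f assms(3) fae] p cis_conv_exp by (simp add: mult_ac)
  have Fcont: "continuous_on UNIV F"
    unfolding F_def fhat_def by (intro continuous_intros continuous_on_fourier_integral f)
  have Fbound: "norm (F k) \<le> (LINT y|lborel. norm (f y))" for k
    using norm_fourier_integral_le[of k f] by (simp add: F_def fhat_def norm_mult)
  have Fm: "F \<in> borel_measurable borel" by (rule borel_measurable_continuous_onI[OF Fcont])
  note [measurable] = Fm borel_measurable_integrable[OF g]
  have lim: "((\<lambda>R. \<integral>\<^sup>+x. ennreal ((cmod (g x - 1 / (2 * of_real pi) *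
          (LINT k:{-R..R}|lborel. cis (k * x) * F k)))\<^sup>2) \<partial>lborel) \<longlongrightarrow> 0) at_top"
  proof -
    have set_eq: "(LINT k:{-R..R}|lebesgue. exp (\<i> * of_real k * of_real x) * F k) =
        (LINT k:{-R..R}|lborel. cis (k * x) * F k)" for R x :: real
    proof -
      have "(\<lambda>k. indicat_real {-R..R} k *\<^sub>R (cis (k * x) * F k)) \<in> borel_measurable lborel" by measurable
      from integral_completion[OF this] show ?thesis
        by (simp add: set_lebesgue_integral_def cis_conv_exp mult.assoc)
    qed
    have "(\<integral>\<^sup>+x. ennreal ((cmod (q x t - 1 / (2 * of_real pi) *
          (LINT k:{-R..R}|lebesgue. exp (\<i> * of_real k * of_real x) * F k)))\<^sup>2) \<partial>lebesgue) =
       (\<integral>\<^sup>+x. ennreal ((cmod (g x - 1 / (2 * of_real pi) *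
          (LINT k:{-R..R}|lborel. cis (k * x) * F k)))\<^sup>2) \<partial>lborel)" for R
      unfolding set_eq nn_integral_completion[symmetric, of lborel]
      by (rule nn_integral_cong_AE) (use gae in \<open>eventually_elim, simp\<close>)
    then show ?thesis
      using assms(5)[OF t] unfolding has_L2_inverse_fourier_def F_eq by simp
  qed
  \<comment> \<open>The backward evolution: the transform of \<open>g\<close> is
    \<open>cis (- poly p k) * fhat k\<close>, and multiplying by the conjugate phase recovers
    \<open>fhat\<close>.\<close>
  have "fhat k = cis (poly p k) * (LINT y|lborel. cis (- (k * y)) * g y)" for k
    unfolding fourier_of_L2_inverse_fourier[OF Fcont Fbound g lim] F_def
    by (simp add: cis_mult flip: mult.assoc)
  then obtain C where C: "\<And>a b h. a \<le> b \<Longrightarrow>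
    norm ((LINT s:{a + h..b + h}|lborel. f s) - (LINT s:{a..b}|lborel. f s))
      \<le> (b - a) * (C * (LINT y|lborel. norm (g (y + h) - g y)))"
    using dispersive_modulus_of_continuity[OF f g _ deg] unfolding fhat_def by blast
  define \<eta> where "\<eta> h = C * (LINT y|lborel. norm (g (y + h) - g y))" for h
  have \<eta>0: "(\<lambda>n. \<eta> (X n)) \<longlonglongrightarrow> 0" if "X \<longlonglongrightarrow> 0" for X
    unfolding \<eta>_def by (rule tendsto_mult_right_zero[OF L1_translation_continuous[OF g that]])
  have agree: "T l = T r"
    if lr: "(canonical_rep (\<lambda>y. T (q0 y)) \<longlongrightarrow> ereal (T l)) (at_left c)"
       "(canonical_rep (\<lambda>y. T (q0 y)) \<longlongrightarrow> ereal (T r)) (at_right c)"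
      and T: "bounded_linear T" and T1: "\<And>z. \<bar>T z\<bar> \<le> norm z" for T :: "complex \<Rightarrow> real" and l r c
  proof (rule one_sided_limits_agree[OF lr _ _ \<eta>0])
    fix x h
    interpret T: bounded_linear T by (rule T)
    let ?A = "\<lambda>x \<delta>. 1 / (2 * \<delta>) * T (LINT y:{x - \<delta>..x + \<delta>}|lborel. f y)"
    \<comment> \<open>The window has length \<open>2 * \<delta>\<close>, which cancels the
      normalization of the average. What is left is free of \<open>\<delta>\<close> and
      \<open>x\<close>, and therefore survives the upper limit.\<close>
    have "\<bar>?A (x + h) \<delta> - ?A x \<delta>\<bar> \<le> \<eta> h" if \<delta>: "\<delta> > 0" for \<delta>
    proof -
      have "\<bar>T (LINT y:{x - \<delta> + h..x + \<delta> + h}|lborel. f y) - T (LINT y:{x - \<delta>..x + \<delta>}|lborel. f y)\<bar> \<le> 2 * \<delta> * \<eta> h"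
        unfolding T.diff[symmetric] \<eta>_def using T1 C[of "x - \<delta>" "x + \<delta>" h] \<delta> by (intro order_trans[OF T1]) simp
      then have "\<bar>T (LINT y:{x - \<delta> + h..x + \<delta> + h}|lborel. f y) - T (LINT y:{x - \<delta>..x + \<delta>}|lborel. f y)\<bar> / (2 * \<delta>) \<le> \<eta> h"
        using \<delta> by (simp add: divide_le_eq mult.commute)
      then show ?thesis
        using \<delta> by (simp add: diff_divide_distrib[symmetric] algebra_simps)
    qed
    then have A: "?A (x + h) \<delta> \<le> ?A x \<delta> + \<eta> h" "?A x \<delta> \<le> ?A (x + h) \<delta> + \<eta> h" if "\<delta> > 0" for \<delta>
      using that by (force simp: abs_le_iff)+
    show "canonical_rep (\<lambda>y. T (q0 y)) (x + h) \<le> canonical_rep (\<lambda>y. T (q0 y)) x + ereal (\<eta> h)"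
      unfolding canonical_rep_borel_rep[OF f assms(3) fae T] by (rule Limsup_at_right_shift_le[OF A(1)])
    show "canonical_rep (\<lambda>y. T (q0 y)) x \<le> canonical_rep (\<lambda>y. T (q0 y)) (x + h) + ereal (\<eta> h)"
      unfolding canonical_rep_borel_rep[OF f assms(3) fae T] by (rule Limsup_at_right_shift_le[OF A(2)])
  qed
  obtain c l r where "rep_tendsto q0 l (at_left c)" "rep_tendsto q0 r (at_right c)" "l \<noteq> r"
    using assms(6) unfolding jump_discontinuity_def by blast
  then show False
    using agree[of Re l c r] agree[of Im l c r] bounded_linear_Re bounded_linear_Im abs_Re_le_cmod abs_Im_le_cmod
    unfolding rep_tendsto_def complex_eq_iff by blast
qed

end
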